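(* Let $R$ be a (commutative) principal ideal domain, $\sigma\in\mathrm{Aut}(R)$, $0\ne a\in R$, and $A=R(\sigma,a)$ the corresponding generalized Weyl algebra. Assume that $a$ is not a unit and that all $\mathcal G$-orbits in $\mathrm{Irr}(R)$ are infinite. Let $a_0$ be any irreducible factor of $a$ that is minimal among the factors of $a$, in the sense that $\sigma^{-k}(a_0)$ is not a factor of $a$ for any $k>0$. For arbitrary $n\ge1$, define an action of $A$ on $V_n(a_0):=R^n$, with standard $R$-basis $e_1,\dots,e_n$, where $R$ acts by left multiplication and, for $r\in R$, $$x\cdot re_i=\sigma^{-1}(r)e_{i+1}\ \text{ for } i<n,\qquad x\cdot re_n=a_0\sigma^{-1}(r)e_1,$$ $$y\cdot re_i=\sigma(ar)e_{i-1}\ \text{ for } i>1,\qquad y\cdot re_1=\sigma\!\left(\tfrac{ra}{a_0}\right)e_n.$$ Under this action, $V_n(a_0)$ is a simple $A$-module which is free of rank $n$ over $R$.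
   Context: Modules are left and unital. The generalized Weyl algebra $R(\sigma,a)$ is the ring generated by $R$, $x$, $y$ subject to $x\sigma(r)=rx$, $yr=\sigma(r)y$ for all $r\in R$, $xy=a$, $yx=\sigma(a)$. $\mathrm{Irr}(R)$ is the set of classes, up to associates, of irreducible elements of $R$; $\mathcal G=\langle\sigma\rangle\le\mathrm{Aut}(R)$ acts on it by $\sigma\cdot[r]=[\sigma(r)]$. *)

theory Defs
  imports "HOL-Algebra.Algebra"
begin

section \<open>Rings presented by generators and relations\<close>

datatype (gens: 'g) ring_expr =
    Gen 'g | Zero | One
  | Neg "'g ring_expr"
  | Plus "'g ring_expr" "'g ring_expr"
  | Times "'g ring_expr" "'g ring_expr"

definition ring_exprs :: "'g set \<Rightarrow> 'g ring_expr set" where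
  "ring_exprs G = {t. gens t \<subseteq> G}"

text \<open>The least congruence on the expressions over \<open>G\<close> that contains the pairs in \<open>P\<close> and
  satisfies the axioms of (unital, not necessarily commutative) rings.\<close>

inductive_set ring_cong ::
    "'g set \<Rightarrow> ('g ring_expr \<times> 'g ring_expr) set \<Rightarrow> ('g ring_expr \<times> 'g ring_expr) set"
  for G P
where
  relation: "(s, t) \<in> P \<Longrightarrow> s \<in> ring_exprs G \<Longrightarrow> t \<in> ring_exprs G \<Longrightarrow> (s, t) \<in> ring_cong G P"
| refl: "s \<in> ring_exprs G \<Longrightarrow> (s, s) \<in> ring_cong G P"
| sym: "(s, t) \<in> ring_cong G P \<Longrightarrow> (t, s) \<in> ring_cong G P"
| trans: "(s, t) \<in> ring_cong G P \<Longrightarrow> (t, u) \<in> ring_cong G P \<Longrightarrow> (s, u) \<in> ring_cong G P"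
| neg: "(s, s') \<in> ring_cong G P \<Longrightarrow> (Neg s, Neg s') \<in> ring_cong G P"
| plus: "(s, s') \<in> ring_cong G P \<Longrightarrow> (t, t') \<in> ring_cong G P \<Longrightarrow>
    (Plus s t, Plus s' t') \<in> ring_cong G P"
| times: "(s, s') \<in> ring_cong G P \<Longrightarrow> (t, t') \<in> ring_cong G P \<Longrightarrow>
    (Times s t, Times s' t') \<in> ring_cong G P"
| plus_assoc: "s \<in> ring_exprs G \<Longrightarrow> t \<in> ring_exprs G \<Longrightarrow> u \<in> ring_exprs G \<Longrightarrow>
    (Plus (Plus s t) u, Plus s (Plus t u)) \<in> ring_cong G P"
| plus_comm: "s \<in> ring_exprs G \<Longrightarrow> t \<in> ring_exprs G \<Longrightarrow>
    (Plus s t, Plus t s) \<in> ring_cong G P"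
| plus_zero: "s \<in> ring_exprs G \<Longrightarrow> (Plus Zero s, s) \<in> ring_cong G P"
| plus_neg: "s \<in> ring_exprs G \<Longrightarrow> (Plus (Neg s) s, Zero) \<in> ring_cong G P"
| times_assoc: "s \<in> ring_exprs G \<Longrightarrow> t \<in> ring_exprs G \<Longrightarrow> u \<in> ring_exprs G \<Longrightarrow>
    (Times (Times s t) u, Times s (Times t u)) \<in> ring_cong G P"
| one_times: "s \<in> ring_exprs G \<Longrightarrow> (Times One s, s) \<in> ring_cong G P"
| times_one: "s \<in> ring_exprs G \<Longrightarrow> (Times s One, s) \<in> ring_cong G P"
| distrib_right: "s \<in> ring_exprs G \<Longrightarrow> t \<in> ring_exprs G \<Longrightarrow> u \<in> ring_exprs G \<Longrightarrow>
    (Times (Plus s t) u, Plus (Times s u) (Times t u)) \<in> ring_cong G P"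
| distrib_left: "s \<in> ring_exprs G \<Longrightarrow> t \<in> ring_exprs G \<Longrightarrow> u \<in> ring_exprs G \<Longrightarrow>
    (Times u (Plus s t), Plus (Times u s) (Times u t)) \<in> ring_cong G P"

definition presented_ring ::
    "'g set \<Rightarrow> ('g ring_expr \<times> 'g ring_expr) set \<Rightarrow> 'g ring_expr set ring" where
  "presented_ring G P =
    \<lparr>carrier = ring_exprs G // ring_cong G P,
     monoid.mult = (\<lambda>C D. \<Union>s\<in>C. \<Union>t\<in>D. ring_cong G P `` {Times s t}),
     one = ring_cong G P `` {One},
     ring.zero = ring_cong G P `` {Zero},
     add = (\<lambda>C D. \<Union>s\<in>C. \<Union>t\<in>D. ring_cong G P `` {Plus s t})\<rparr>"

lemma ring_exprs_simps [simp]: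
  "Gen g \<in> ring_exprs G \<longleftrightarrow> g \<in> G"
  "Zero \<in> ring_exprs G"
  "One \<in> ring_exprs G"
  "Neg s \<in> ring_exprs G \<longleftrightarrow> s \<in> ring_exprs G"
  "Plus s t \<in> ring_exprs G \<longleftrightarrow> s \<in> ring_exprs G \<and> t \<in> ring_exprs G"
  "Times s t \<in> ring_exprs G \<longleftrightarrow> s \<in> ring_exprs G \<and> t \<in> ring_exprs G"
  by (auto simp: ring_exprs_def)

lemma ring_cong_exprs:
  "(s, t) \<in> ring_cong G P \<Longrightarrow> s \<in> ring_exprs G \<and> t \<in> ring_exprs G"
  by (induction rule: ring_cong.induct) auto

lemma equiv_ring_cong: "equiv (ring_exprs G) (ring_cong G P)"
  using ring_cong_exprs
  by (intro equivI refl_onI symI transI) (auto intro: ring_cong.intros(2-4))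

lemma presented_ring_closed:
  assumes "s \<in> ring_exprs G"
  shows "ring_cong G P `` {s} \<in> carrier (presented_ring G P)"
  using assms by (auto simp: presented_ring_def intro: quotientI)

lemma presented_ring_ops:
  assumes "s \<in> ring_exprs G" "t \<in> ring_exprs G"
  shows "ring_cong G P `` {s} \<otimes>\<^bsub>presented_ring G P\<^esub> ring_cong G P `` {t} = ring_cong G P `` {Times s t}"
    and "ring_cong G P `` {s} \<oplus>\<^bsub>presented_ring G P\<^esub> ring_cong G P `` {t} = ring_cong G P `` {Plus s t}"
proof -
  have "congruent2 (ring_cong G P) (ring_cong G P) (\<lambda>s t. ring_cong G P `` {Times s t})"
    by (intro congruent2I' equiv_class_eq[OF equiv_ring_cong] ring_cong.times)
  from UN_equiv_class2[OF equiv_ring_cong equiv_ring_cong this assms]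
  show "ring_cong G P `` {s} \<otimes>\<^bsub>presented_ring G P\<^esub> ring_cong G P `` {t} = ring_cong G P `` {Times s t}"
    by (simp add: presented_ring_def)
  have "congruent2 (ring_cong G P) (ring_cong G P) (\<lambda>s t. ring_cong G P `` {Plus s t})"
    by (intro congruent2I' equiv_class_eq[OF equiv_ring_cong] ring_cong.plus)
  from UN_equiv_class2[OF equiv_ring_cong equiv_ring_cong this assms]
  show "ring_cong G P `` {s} \<oplus>\<^bsub>presented_ring G P\<^esub> ring_cong G P `` {t} = ring_cong G P `` {Plus s t}"
    by (simp add: presented_ring_def)
qed

lemma presented_ring_carrierE:
  assumes "c \<in> carrier (presented_ring G P)"
  obtains s where "s \<in> ring_exprs G" "c = ring_cong G P `` {s}"
  using assms by (auto simp: presented_ring_def elim: quotientE)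

lemma ring_presented_ring: "ring (presented_ring G P)"
proof -
  let ?A = "presented_ring G P" and ?c = "\<lambda>s. ring_cong G P `` {s}"
  have eq: "?c s = ?c t" if "(s, t) \<in> ring_cong G P" for s t
    using equiv_class_eq[OF equiv_ring_cong that] .
  have one: "\<one>\<^bsub>?A\<^esub> = ?c One" and zero: "\<zero>\<^bsub>?A\<^esub> = ?c Zero"
    by (simp_all add: presented_ring_def)
  note cl = presented_ring_closed and ops = presented_ring_ops
  show ?thesis
  proof (rule ringI)
    show "abelian_group ?A"
    proof (rule abelian_groupI)
      fix x assume "x \<in> carrier ?A"
      then obtain s where s: "s \<in> ring_exprs G" "x = ?c s" by (rule presented_ring_carrierE)
      have "?c (Neg s) \<oplus>\<^bsub>?A\<^esub> x = \<zero>\<^bsub>?A\<^esub>"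
        using s by (simp add: ops zero eq[OF ring_cong.plus_neg])
      then show "\<exists>y\<in>carrier ?A. y \<oplus>\<^bsub>?A\<^esub> x = \<zero>\<^bsub>?A\<^esub>"
        using s by (intro bexI[of _ "?c (Neg s)"]) (auto intro: cl)
    next
      fix x y assume "x \<in> carrier ?A" "y \<in> carrier ?A"
      then show "x \<oplus>\<^bsub>?A\<^esub> y = y \<oplus>\<^bsub>?A\<^esub> x"
        by (elim presented_ring_carrierE) (simp add: ops eq[OF ring_cong.plus_comm])
    qed (elim presented_ring_carrierE; simp add: ops zero cl
        eq[OF ring_cong.plus_assoc] eq[OF ring_cong.plus_zero]; fail | simp add: zero cl; fail)+
    show "Group.monoid ?A"
      by (rule monoidI; (elim presented_ring_carrierE)?) (simp_all add: ops one cl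
          eq[OF ring_cong.times_assoc] eq[OF ring_cong.one_times] eq[OF ring_cong.times_one])
  qed (elim presented_ring_carrierE; simp add: ops
        eq[OF ring_cong.distrib_right] eq[OF ring_cong.distrib_left])+
qed


section \<open>Generalized Weyl algebras\<close>

datatype 'a gwa_gen = Coef 'a | GenX | GenY

definition gwa_gens :: "('a, 'b) ring_scheme \<Rightarrow> 'a gwa_gen set" where
  "gwa_gens R = Coef ` carrier R \<union> {GenX, GenY}"

text \<open>The first three families say that \<open>r \<mapsto> Coef r\<close> is a ring homomorphism.\<close>

inductive_set gwa_rels ::
    "('a, 'b) ring_scheme \<Rightarrow> ('a \<Rightarrow> 'a) \<Rightarrow> 'a \<Rightarrow> ('a gwa_gen ring_expr \<times> 'a gwa_gen ring_expr) set"
  for R (structure) and \<sigma> a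
where
  "(Gen (Coef \<one>), One) \<in> gwa_rels R \<sigma> a"
| "r \<in> carrier R \<Longrightarrow> s \<in> carrier R \<Longrightarrow>
    (Gen (Coef (r \<oplus> s)), Plus (Gen (Coef r)) (Gen (Coef s))) \<in> gwa_rels R \<sigma> a"
| "r \<in> carrier R \<Longrightarrow> s \<in> carrier R \<Longrightarrow>
    (Gen (Coef (r \<otimes> s)), Times (Gen (Coef r)) (Gen (Coef s))) \<in> gwa_rels R \<sigma> a"
| "r \<in> carrier R \<Longrightarrow>
    (Times (Gen GenX) (Gen (Coef (\<sigma> r))), Times (Gen (Coef r)) (Gen GenX)) \<in> gwa_rels R \<sigma> a"
| "r \<in> carrier R \<Longrightarrow>
    (Times (Gen GenY) (Gen (Coef r)), Times (Gen (Coef (\<sigma> r))) (Gen GenY)) \<in> gwa_rels R \<sigma> a"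
| "(Times (Gen GenX) (Gen GenY), Gen (Coef a)) \<in> gwa_rels R \<sigma> a"
| "(Times (Gen GenY) (Gen GenX), Gen (Coef (\<sigma> a))) \<in> gwa_rels R \<sigma> a"

definition gwa :: "('a, 'b) ring_scheme \<Rightarrow> ('a \<Rightarrow> 'a) \<Rightarrow> 'a \<Rightarrow> 'a gwa_gen ring_expr set ring" where
  "gwa R \<sigma> a = presented_ring (gwa_gens R) (gwa_rels R \<sigma> a)"

definition gwa_coef :: "('a, 'b) ring_scheme \<Rightarrow> ('a \<Rightarrow> 'a) \<Rightarrow> 'a \<Rightarrow> 'a \<Rightarrow> 'a gwa_gen ring_expr set" where
  "gwa_coef R \<sigma> a r = ring_cong (gwa_gens R) (gwa_rels R \<sigma> a) `` {Gen (Coef r)}"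

definition gwa_x :: "('a, 'b) ring_scheme \<Rightarrow> ('a \<Rightarrow> 'a) \<Rightarrow> 'a \<Rightarrow> 'a gwa_gen ring_expr set" where
  "gwa_x R \<sigma> a = ring_cong (gwa_gens R) (gwa_rels R \<sigma> a) `` {Gen GenX}"

definition gwa_y :: "('a, 'b) ring_scheme \<Rightarrow> ('a \<Rightarrow> 'a) \<Rightarrow> 'a \<Rightarrow> 'a gwa_gen ring_expr set" where
  "gwa_y R \<sigma> a = ring_cong (gwa_gens R) (gwa_rels R \<sigma> a) `` {Gen GenY}"


section \<open>Modules\<close>

text \<open>Left unital modules over an arbitrary ring; the library locale \<open>module\<close> requires the
  ring to be commutative.\<close>

locale left_module = A?: ring A + M?: abelian_group M
  for A :: "('a, 'b) ring_scheme" (structure) and M :: "('a, 'm, 'c) module_scheme" (structure) +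
  assumes smult_closed:
      "\<lbrakk>s \<in> carrier A; u \<in> carrier M\<rbrakk> \<Longrightarrow> s \<odot>\<^bsub>M\<^esub> u \<in> carrier M"
    and smult_l_distr:
      "\<lbrakk>s \<in> carrier A; t \<in> carrier A; u \<in> carrier M\<rbrakk> \<Longrightarrow>
        (s \<oplus>\<^bsub>A\<^esub> t) \<odot>\<^bsub>M\<^esub> u = s \<odot>\<^bsub>M\<^esub> u \<oplus>\<^bsub>M\<^esub> t \<odot>\<^bsub>M\<^esub> u"
    and smult_r_distr:
      "\<lbrakk>s \<in> carrier A; u \<in> carrier M; v \<in> carrier M\<rbrakk> \<Longrightarrow>
        s \<odot>\<^bsub>M\<^esub> (u \<oplus>\<^bsub>M\<^esub> v) = s \<odot>\<^bsub>M\<^esub> u \<oplus>\<^bsub>M\<^esub> s \<odot>\<^bsub>M\<^esub> v"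
    and smult_assoc:
      "\<lbrakk>s \<in> carrier A; t \<in> carrier A; u \<in> carrier M\<rbrakk> \<Longrightarrow>
        (s \<otimes>\<^bsub>A\<^esub> t) \<odot>\<^bsub>M\<^esub> u = s \<odot>\<^bsub>M\<^esub> (t \<odot>\<^bsub>M\<^esub> u)"
    and smult_one:
      "u \<in> carrier M \<Longrightarrow> \<one>\<^bsub>A\<^esub> \<odot>\<^bsub>M\<^esub> u = u"

definition simple_module :: "('a, 'b) ring_scheme \<Rightarrow> ('a, 'm, 'c) module_scheme \<Rightarrow> bool" where
  "simple_module A M \<longleftrightarrow>
    left_module A M \<and> carrier M \<noteq> {\<zero>\<^bsub>M\<^esub>} \<and>
    (\<forall>N. submodule N A M \<longrightarrow> N = {\<zero>\<^bsub>M\<^esub>} \<or> N = carrier M)"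

definition free_of_rank :: "('a, 'b) ring_scheme \<Rightarrow> ('a, 'm, 'c) module_scheme \<Rightarrow> nat \<Rightarrow> bool" where
  "free_of_rank R M n \<longleftrightarrow>
    module R M \<and>
    (\<exists>B. B \<subseteq> carrier M \<and> finite B \<and> card B = n \<and>
      (\<forall>v\<in>carrier M. \<exists>!c. c \<in> B \<rightarrow>\<^sub>E carrier R \<and> v = (\<Oplus>\<^bsub>M\<^esub>b\<in>B. c b \<odot>\<^bsub>M\<^esub> b)))"

definition restrict_scalars :: "('r \<Rightarrow> 'a) \<Rightarrow> ('a, 'm) module \<Rightarrow> ('r, 'm) module" where
  "restrict_scalars f M =
    \<lparr>carrier = carrier M, monoid.mult = monoid.mult M, one = one M,
     ring.zero = ring.zero M, add = add M,
     smult = (\<lambda>r. smult M (f r))\<rparr>"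

text \<open>The \<open>R\<close>-module \<open>R\<^sup>n\<close>. The fields \<open>mult\<close> and \<open>one\<close>, inherited by the record type \<open>module\<close>
  from \<open>ring\<close>, play no role in modules and are left undefined here and below.\<close>

definition std_module :: "('a, 'b) ring_scheme \<Rightarrow> nat \<Rightarrow> ('a, nat \<Rightarrow> 'a) module" where
  "std_module R n =
    \<lparr>carrier = {1..n} \<rightarrow>\<^sub>E carrier R,
     monoid.mult = undefined, one = undefined,
     ring.zero = (\<lambda>j\<in>{1..n}. \<zero>\<^bsub>R\<^esub>),
     add = (\<lambda>u v. \<lambda>j\<in>{1..n}. u j \<oplus>\<^bsub>R\<^esub> v j),
     smult = (\<lambda>r v. \<lambda>j\<in>{1..n}. r \<otimes>\<^bsub>R\<^esub> v j)\<rparr>"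

definition std_basis :: "('a, 'b) ring_scheme \<Rightarrow> nat \<Rightarrow> nat \<Rightarrow> nat \<Rightarrow> 'a" where
  "std_basis R n i = (\<lambda>j\<in>{1..n}. if j = i then \<one>\<^bsub>R\<^esub> else \<zero>\<^bsub>R\<^esub>)"


section \<open>Ring automorphisms and their action on classes of irreducible elements\<close>

definition ring_AutoGroup :: "('a, 'b) ring_scheme \<Rightarrow> ('a \<Rightarrow> 'a) monoid" where
  "ring_AutoGroup R = BijGroup (carrier R) \<lparr>carrier := ring_hom R R \<inter> Bij (carrier R)\<rparr>"

abbreviation assoc_class :: "('a, 'b) ring_scheme \<Rightarrow> 'a \<Rightarrow> 'a set" where
  "assoc_class R r \<equiv> class_of\<^bsub>division_rel R\<^esub> r"

definition Irr :: "('a, 'b) ring_scheme \<Rightarrow> 'a set set" where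
  "Irr R = {assoc_class R p | p. p \<in> carrier R \<and> ring_irreducible\<^bsub>R\<^esub> p}"

text \<open>\<open>\<tau> \<cdot> [r] = [\<tau> r]\<close>, as a union over all representatives \<open>r\<close> of the class.\<close>

definition class_action :: "('a, 'b) ring_scheme \<Rightarrow> ('a \<Rightarrow> 'a) \<Rightarrow> 'a set \<Rightarrow> 'a set" where
  "class_action R \<tau> C = (\<Union>r\<in>C. assoc_class R (\<tau> r))"


section \<open>The modules \<open>V\<^sub>n(a\<^sub>0)\<close>\<close>

text \<open>The unique \<open>q\<close> with \<open>c = q d\<close>; meaningful when \<open>d\<close> is a nonzero divisor of \<open>c\<close> in a domain.\<close>

definition exact_quotient :: "('a, 'b) ring_scheme \<Rightarrow> 'a \<Rightarrow> 'a \<Rightarrow> 'a" where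
  "exact_quotient R c d = (THE q. q \<in> carrier R \<and> c = q \<otimes>\<^bsub>R\<^esub> d)"

definition V_module ::
    "('a, 'b) ring_scheme \<Rightarrow> nat \<Rightarrow> ('c \<Rightarrow> (nat \<Rightarrow> 'a) \<Rightarrow> nat \<Rightarrow> 'a) \<Rightarrow> ('c, nat \<Rightarrow> 'a) module" where
  "V_module R n act =
    \<lparr>carrier = carrier (std_module R n), monoid.mult = undefined, one = undefined,
     ring.zero = ring.zero (std_module R n), add = add (std_module R n), smult = act\<rparr>"

definition V_action ::
    "('a, 'b) ring_scheme \<Rightarrow> ('a \<Rightarrow> 'a) \<Rightarrow> 'a \<Rightarrow> 'a \<Rightarrow> nat \<Rightarrow>
      ('a gwa_gen ring_expr set \<Rightarrow> (nat \<Rightarrow> 'a) \<Rightarrow> nat \<Rightarrow> 'a) \<Rightarrow> bool" where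
  "V_action R \<sigma> a a\<^sub>0 n act \<longleftrightarrow>
    (let A = gwa R \<sigma> a; x = gwa_x R \<sigma> a; y = gwa_y R \<sigma> a;
         M = std_module R n; e = std_basis R n;
         \<sigma>' = inv\<^bsub>ring_AutoGroup R\<^esub> \<sigma>
     in act \<in> carrier A \<rightarrow>\<^sub>E carrier M \<rightarrow>\<^sub>E carrier M \<and>
        left_module A (V_module R n act) \<and>
        (\<forall>r\<in>carrier R. \<forall>v\<in>carrier M. act (gwa_coef R \<sigma> a r) v = r \<odot>\<^bsub>M\<^esub> v) \<and>
        (\<forall>r\<in>carrier R.
          (\<forall>i\<in>{1..<n}. act x (r \<odot>\<^bsub>M\<^esub> e i) = \<sigma>' r \<odot>\<^bsub>M\<^esub> e (i + 1)) \<and>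
          act x (r \<odot>\<^bsub>M\<^esub> e n) = (a\<^sub>0 \<otimes>\<^bsub>R\<^esub> \<sigma>' r) \<odot>\<^bsub>M\<^esub> e 1 \<and>
          (\<forall>i\<in>{2..n}. act y (r \<odot>\<^bsub>M\<^esub> e i) = \<sigma> (a \<otimes>\<^bsub>R\<^esub> r) \<odot>\<^bsub>M\<^esub> e (i - 1)) \<and>
          act y (r \<odot>\<^bsub>M\<^esub> e 1) = \<sigma> (exact_quotient R (r \<otimes>\<^bsub>R\<^esub> a) a\<^sub>0) \<odot>\<^bsub>M\<^esub> e n))"

end

theory Submission
  imports Defs
begin

text \<open>Relations hold on \<open>R\<^sup>n\<close> coordinatewise, so the universal property of the presentation gives the
  action. For simplicity, let \<open>N \<noteq> 0\<close> be a submodule and \<open>v \<in> N\<close> nonzero of minimal support. Since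
  \<open>x\<^sup>n\<close> acts on the \<open>i\<close>-th coordinate as \<open>r \<mapsto> \<sigma>\<^bsup>1-i\<^esup>(a\<^sub>0) \<sigma>\<^bsup>-n\<^esup>(r)\<close>, minimality makes
  \<open>v\<^sub>i x\<^sup>n v - \<sigma>\<^bsup>1-i\<^esup>(a\<^sub>0) \<sigma>\<^bsup>-n\<^esup>(v\<^sub>i) v\<close> vanish; following irreducible factors along their infinite
  \<open>\<sigma>\<^sup>n\<close>-orbits shows that this is impossible when the support has two elements. So \<open>N\<close> contains a
  nonzero multiple of some \<open>e\<^sub>i\<close>, and \<open>{r. r e\<^sub>1 \<in> N} = (b)\<close> with \<open>b \<noteq> 0\<close>. Applying \<open>x\<^sup>n\<close> and
  \<open>y\<^sup>n\<close> to \<open>b e\<^sub>1\<close> bounds the irreducible factors of \<open>b\<close> from both ends of their orbits: the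
  \<open>x\<close> side forces them into \<open>\<sigma>\<^bsup>-nl\<^esup>(a\<^sub>0)\<close>, and then the \<open>y\<close> side yields \<open>k > 0\<close> with
  \<open>\<sigma>\<^bsup>-k\<^esup>(a\<^sub>0)\<close> dividing \<open>a\<close>, contrary to the minimality of \<open>a\<^sub>0\<close>. Hence \<open>b\<close> is a unit.\<close>


section \<open>Modules over presented rings\<close>

text \<open>Evaluation of expressions in the endomorphism ring of the additive group of
  \<open>M\<close>: operators chosen for the generators extend to all expressions.
  \<open>Times\<close> becomes composition, in the order of a left action.\<close>

primrec expr_action ::
    "('m, 'c) ring_scheme \<Rightarrow> ('g \<Rightarrow> 'm \<Rightarrow> 'm) \<Rightarrow> 'g ring_expr \<Rightarrow> 'm \<Rightarrow> 'm" where
  "expr_action M \<phi> (Gen g) v = \<phi> g v"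
| "expr_action M \<phi> Zero v = \<zero>\<^bsub>M\<^esub>"
| "expr_action M \<phi> One v = v"
| "expr_action M \<phi> (Neg s) v = \<ominus>\<^bsub>M\<^esub> expr_action M \<phi> s v"
| "expr_action M \<phi> (Plus s t) v = expr_action M \<phi> s v \<oplus>\<^bsub>M\<^esub> expr_action M \<phi> t v"
| "expr_action M \<phi> (Times s t) v = expr_action M \<phi> s (expr_action M \<phi> t v)"

text \<open>Values outside the carrier are left free, so that scalar multiplications qualify as they
  stand.\<close>

definition additive_endo :: "('m, 'c) ring_scheme \<Rightarrow> ('m \<Rightarrow> 'm) \<Rightarrow> bool" where
  "additive_endo M f \<longleftrightarrow> f \<in> carrier M \<rightarrow> carrier M \<and>
    (\<forall>u\<in>carrier M. \<forall>v\<in>carrier M. f (u \<oplus>\<^bsub>M\<^esub> v) = f u \<oplus>\<^bsub>M\<^esub> f v)"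

lemma additive_endoI:
  assumes "\<And>v. v \<in> carrier M \<Longrightarrow> f v \<in> carrier M"
    and "\<And>u v. u \<in> carrier M \<Longrightarrow> v \<in> carrier M \<Longrightarrow> f (u \<oplus>\<^bsub>M\<^esub> v) = f u \<oplus>\<^bsub>M\<^esub> f v"
  shows "additive_endo M f"
  using assms by (auto simp: additive_endo_def)

lemma additive_endoD:
  assumes "additive_endo M f"
  shows "v \<in> carrier M \<Longrightarrow> f v \<in> carrier M"
    and "u \<in> carrier M \<Longrightarrow> v \<in> carrier M \<Longrightarrow> f (u \<oplus>\<^bsub>M\<^esub> v) = f u \<oplus>\<^bsub>M\<^esub> f v"
  using assms by (auto simp: additive_endo_def)

context abelian_group
begin

lemma additive_endo_zero:
  assumes "additive_endo G f"
  shows "f \<zero> = \<zero>"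
proof -
  have "f \<zero> \<oplus> f \<zero> = f \<zero>"
    using additive_endoD[OF assms] by (metis l_zero zero_closed)
  then show ?thesis
    using additive_endoD(1)[OF assms zero_closed] by (metis add.r_cancel_one)
qed

lemma additive_endo_expr_action:
  assumes \<phi>: "\<And>g. g \<in> S \<Longrightarrow> additive_endo G (\<phi> g)" and "s \<in> ring_exprs S"
  shows "additive_endo G (expr_action G \<phi> s)"
  using assms(2)
proof (induction s)
  case (Gen g)
  then show ?case using \<phi>[of g] by (simp add: additive_endo_def)
next
  case (Neg s)
  then show ?case by (auto simp: additive_endo_def minus_add Pi_iff)
next
  case (Plus s t)
  then show ?case by (auto simp: additive_endo_def a_ac Pi_iff)
next
  case (Times s t)
  then show ?case by (auto simp: additive_endo_def Pi_iff)
qed (auto simp: additive_endo_def)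

text \<open>Additive endomorphisms form a ring, so evaluation respects every ring axiom, and it
  respects \<open>P\<close> by assumption. This is what makes evaluation well defined on classes of
  expressions.\<close>

lemma expr_action_ring_cong:
  assumes \<phi>: "\<And>g. g \<in> S \<Longrightarrow> additive_endo G (\<phi> g)"
    and rel: "\<And>s t v. (s, t) \<in> P \<Longrightarrow> s \<in> ring_exprs S \<Longrightarrow> t \<in> ring_exprs S \<Longrightarrow> v \<in> carrier G \<Longrightarrow>
      expr_action G \<phi> s v = expr_action G \<phi> t v"
    and "(s, t) \<in> ring_cong S P" and "v \<in> carrier G"
  shows "expr_action G \<phi> s v = expr_action G \<phi> t v"
  using assms(3,4)
proof (induction arbitrary: v rule: ring_cong.induct)
  case (relation s t)
  then show ?case by (rule rel)
next
  \<comment> \<open>The induction hypothesis for the left factor is applied at the value of the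
    right factor, which therefore has to lie in the carrier.\<close>
  case (times s s' t t')
  then show ?case
    using additive_endoD(1)[OF additive_endo_expr_action[where S = S and \<phi> = \<phi>, OF \<phi>]]
      ring_cong_exprs[of t t' S P]
    by simp
next
  case (plus_assoc s t u)
  then show ?case
    using additive_endo_expr_action[where S = S and \<phi> = \<phi>, OF \<phi>] by (simp add: a_assoc additive_endoD)
next
  case (plus_comm s t)
  then show ?case
    using additive_endo_expr_action[where S = S and \<phi> = \<phi>, OF \<phi>] by (simp add: a_comm additive_endoD)
next
  case (plus_zero s)
  then show ?case
    using additive_endo_expr_action[where S = S and \<phi> = \<phi>, OF \<phi>] by (simp add: additive_endoD)
next
  case (plus_neg s)
  then show ?case
    using additive_endo_expr_action[where S = S and \<phi> = \<phi>, OF \<phi>] by (simp add: l_neg additive_endoD)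
next
  case (distrib_left s t u)
  then show ?case
    using additive_endo_expr_action[where S = S and \<phi> = \<phi>, OF \<phi>] by (simp add: additive_endoD)
qed simp_all

end

text \<open>Once a class acts by evaluating a representative, the module laws are the clauses of
  \<open>expr_action\<close> together with additivity.\<close>

lemma left_module_presented_ringI:
  assumes "abelian_group M"
    and \<phi>: "\<And>g. g \<in> S \<Longrightarrow> additive_endo M (\<phi> g)"
    and smult: "\<And>s v. s \<in> ring_exprs S \<Longrightarrow> v \<in> carrier M \<Longrightarrow>
      (ring_cong S P `` {s}) \<odot>\<^bsub>M\<^esub> v = expr_action M \<phi> s v"
  shows "left_module (presented_ring S P) M"
proof -
  interpret M: abelian_group M by fact
  have one: "\<one>\<^bsub>presented_ring S P\<^esub> = ring_cong S P `` {One}"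
    by (simp add: presented_ring_def)
  note endo = M.additive_endo_expr_action[where S = S and \<phi> = \<phi>, OF \<phi>]
  have cl: "expr_action M \<phi> s v \<in> carrier M" if "s \<in> ring_exprs S" "v \<in> carrier M" for s v
    using additive_endoD(1)[OF endo] that by blast
  have add: "expr_action M \<phi> s (u \<oplus>\<^bsub>M\<^esub> v) = expr_action M \<phi> s u \<oplus>\<^bsub>M\<^esub> expr_action M \<phi> s v"
    if "s \<in> ring_exprs S" "u \<in> carrier M" "v \<in> carrier M" for s u v
    using additive_endoD(2)[OF endo] that by blast
  show ?thesis
    by (intro left_module.intro left_module_axioms.intro ring_presented_ring assms(1);
        (elim presented_ring_carrierE)?; simp add: presented_ring_ops one smult cl add)
qed

text \<open>The existence half of the universal property: operators on the generators that satisfy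
  the relations induce an action of the whole ring.\<close>

lemma left_module_presented_ring_exists:
  fixes M :: "('m, 'c) ring_scheme"
  assumes "abelian_group M"
    and \<phi>: "\<And>g. g \<in> S \<Longrightarrow> additive_endo M (\<phi> g)"
    and rel: "\<And>s t v. (s, t) \<in> P \<Longrightarrow> s \<in> ring_exprs S \<Longrightarrow> t \<in> ring_exprs S \<Longrightarrow> v \<in> carrier M \<Longrightarrow>
      expr_action M \<phi> s v = expr_action M \<phi> t v"
  obtains act where "act \<in> carrier (presented_ring S P) \<rightarrow>\<^sub>E carrier M \<rightarrow>\<^sub>E carrier M"
    and "\<And>s v. s \<in> ring_exprs S \<Longrightarrow> v \<in> carrier M \<Longrightarrow>
      act (ring_cong S P `` {s}) v = expr_action M \<phi> s v"
proof -
  interpret M: abelian_group M by fact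
  \<comment> \<open>The chosen representative does not matter, by
    \<open>expr_action_ring_cong\<close>. Both arguments are restricted because the action has to be
    extensional in each of them.\<close>
  define act where "act = (\<lambda>C\<in>carrier (presented_ring S P). \<lambda>v\<in>carrier M.
    expr_action M \<phi> (SOME s. s \<in> C) v)"
  have *: "act (ring_cong S P `` {s}) v = expr_action M \<phi> s v"
    if s: "s \<in> ring_exprs S" and v: "v \<in> carrier M" for s v
  proof -
    let ?C = "ring_cong S P `` {s}"
    have "s \<in> ?C" using ring_cong.refl[OF s] by blast
    then have "(SOME s. s \<in> ?C) \<in> ?C" by (rule someI)
    then have "(s, SOME s. s \<in> ?C) \<in> ring_cong S P" by blast
    then have "expr_action M \<phi> s v = expr_action M \<phi> (SOME s. s \<in> ?C) v"
      using M.expr_action_ring_cong[where \<phi> = \<phi>, OF \<phi> rel] v by blast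
    then show ?thesis
      using presented_ring_closed[OF s] v by (simp add: act_def)
  qed
  have "act C v \<in> carrier M" if C: "C \<in> carrier (presented_ring S P)" and v: "v \<in> carrier M" for C v
  proof -
    obtain s where s: "s \<in> ring_exprs S" "C = ring_cong S P `` {s}"
      using C by (rule presented_ring_carrierE)
    then show ?thesis
      using *[OF s(1) v] additive_endoD(1)[OF M.additive_endo_expr_action[where S = S and \<phi> = \<phi>, OF \<phi>] v]
      by metis
  qed
  then have "act \<in> carrier (presented_ring S P) \<rightarrow>\<^sub>E carrier M \<rightarrow>\<^sub>E carrier M"
    by (auto simp: act_def PiE_iff)
  with * that show ?thesis by blast
qed

section \<open>Module structures are determined by the generators\<close>

lemma (in left_module) smult_zero:
  assumes "u \<in> carrier M"
  shows "\<zero>\<^bsub>A\<^esub> \<odot>\<^bsub>M\<^esub> u = \<zero>\<^bsub>M\<^esub>"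
proof -
  have "\<zero>\<^bsub>A\<^esub> \<odot>\<^bsub>M\<^esub> u \<oplus>\<^bsub>M\<^esub> \<zero>\<^bsub>A\<^esub> \<odot>\<^bsub>M\<^esub> u = \<zero>\<^bsub>A\<^esub> \<odot>\<^bsub>M\<^esub> u"
    using smult_l_distr[OF A.zero_closed A.zero_closed assms] by simp
  then show ?thesis
    using smult_closed[OF A.zero_closed assms] by (metis M.add.r_cancel_one)
qed

lemma (in left_module) additive_endo_smult:
  "s \<in> carrier A \<Longrightarrow> additive_endo M (smult M s)"
  by (intro additive_endoI smult_closed smult_r_distr)

text \<open>The uniqueness half of the universal property: by induction on the expression, the
  module laws force the action of each class from that of the classes of generators.\<close>

lemma left_module_presented_ring_smult:
  assumes "left_module (presented_ring S P) M" and "s \<in> ring_exprs S" and "v \<in> carrier M"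
  shows "(ring_cong S P `` {s}) \<odot>\<^bsub>M\<^esub> v =
    expr_action M (\<lambda>g. smult M (ring_cong S P `` {Gen g})) s v"
  using assms(2,3)
proof (induction s arbitrary: v)
  interpret left_module "presented_ring S P" M by fact
  let ?c = "\<lambda>s. ring_cong S P `` {s}"
  {
    case Zero
    then show ?case using smult_zero by (simp add: presented_ring_def)
  next
    case One
    then show ?case using smult_one by (simp add: presented_ring_def)
  next
    case (Neg s)
    then have s: "s \<in> ring_exprs S" by simp
    \<comment> \<open>No module law mentions negation; the value is identified as the additive
      inverse through the relation \<open>plus_neg\<close>.\<close>
    have "?c (Neg s) \<odot>\<^bsub>M\<^esub> v \<oplus>\<^bsub>M\<^esub> ?c s \<odot>\<^bsub>M\<^esub> v = ?c (Plus (Neg s) s) \<odot>\<^bsub>M\<^esub> v"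
      using smult_l_distr[of "?c (Neg s)" "?c s" v] Neg s
      by (simp add: presented_ring_ops presented_ring_closed)
    also have "\<dots> = \<zero>\<^bsub>M\<^esub>"
      using smult_zero[OF Neg(3)] equiv_class_eq[OF equiv_ring_cong ring_cong.plus_neg[OF s]]
      by (simp add: presented_ring_def)
    finally have "?c (Neg s) \<odot>\<^bsub>M\<^esub> v = \<ominus>\<^bsub>M\<^esub> (?c s \<odot>\<^bsub>M\<^esub> v)"
      using s Neg.prems by (intro M.minus_equality[symmetric]) (auto intro!: smult_closed presented_ring_closed)
    then show ?case using Neg by simp
  next
    case (Plus s t)
    then show ?case
      using smult_l_distr[of "?c s" "?c t" v] by (simp add: presented_ring_ops presented_ring_closed)
  next
    case (Times s t)
    then have "expr_action M (\<lambda>g. smult M (?c (Gen g))) t v \<in> carrier M"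
      using smult_closed[of "?c t" v] by (simp add: presented_ring_closed)
    with Times show ?case
      using smult_assoc[of "?c s" "?c t" v] by (simp add: presented_ring_ops presented_ring_closed)
  }
qed simp

text \<open>The operators are compared only on the carrier, so the \<open>Times\<close> case needs
  intermediate values to stay there; additivity of \<open>\<phi>\<close> provides this.\<close>

lemma expr_action_fun_cong:
  assumes "abelian_group M"
    and \<phi>: "\<And>g. g \<in> S \<Longrightarrow> additive_endo M (\<phi> g)"
    and eq: "\<And>g v. g \<in> S \<Longrightarrow> v \<in> carrier M \<Longrightarrow> \<phi> g v = \<psi> g v"
    and "s \<in> ring_exprs S" and "v \<in> carrier M"
  shows "expr_action M \<phi> s v = expr_action M \<psi> s v"
  using assms(4,5)
proof (induction s arbitrary: v)
  case (Times s t)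
  from Times.prems have "expr_action M \<phi> t v \<in> carrier M"
    using additive_endoD(1)[OF abelian_group.additive_endo_expr_action[where S = S and \<phi> = \<phi>, OF assms(1) \<phi>]]
    by auto
  with Times show ?case by simp
qed (simp_all add: eq)


section \<open>The module \<open>R\<^sup>n\<close>\<close>

context cring
begin

lemma std_module_simps:
  "carrier (std_module R n) = {1..n} \<rightarrow>\<^sub>E carrier R"
  "\<zero>\<^bsub>std_module R n\<^esub> = (\<lambda>j\<in>{1..n}. \<zero>)"
  "u \<oplus>\<^bsub>std_module R n\<^esub> v = (\<lambda>j\<in>{1..n}. u j \<oplus> v j)"
  "r \<odot>\<^bsub>std_module R n\<^esub> v = (\<lambda>j\<in>{1..n}. r \<otimes> v j)"
  by (simp_all add: std_module_def)

lemma std_module_coord: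
  "v \<in> carrier (std_module R n) \<Longrightarrow> j \<in> {1..n} \<Longrightarrow> v j \<in> carrier R"
  by (auto simp: std_module_simps)

lemma std_module_eqI:
  assumes "u \<in> carrier (std_module R n)" and "v \<in> carrier (std_module R n)"
    and "\<And>j. j \<in> {1..n} \<Longrightarrow> u j = v j"
  shows "u = v"
  using assms(1,2) unfolding std_module_simps by (rule PiE_ext) (rule assms(3))

lemma std_basis_closed: "std_basis R n i \<in> carrier (std_module R n)"
  by (auto simp: std_basis_def std_module_simps)

lemma smult_std_basis:
  assumes "r \<in> carrier R"
  shows "r \<odot>\<^bsub>std_module R n\<^esub> std_basis R n i = (\<lambda>j\<in>{1..n}. if j = i then r else \<zero>)"
  using assms by (auto simp: std_basis_def std_module_simps restrict_def fun_eq_iff)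

lemma module_std_module: "module R (std_module R n)"
proof (rule moduleI)
  show "cring R" by (rule is_cring)
  show "abelian_group (std_module R n)"
  proof (rule abelian_groupI)
    fix u assume u: "u \<in> carrier (std_module R n)"
    show "\<exists>v\<in>carrier (std_module R n). v \<oplus>\<^bsub>std_module R n\<^esub> u = \<zero>\<^bsub>std_module R n\<^esub>"
      using u std_module_coord[OF u]
      by (intro bexI[of _ "\<lambda>j\<in>{1..n}. \<ominus> u j"])
        (auto simp: std_module_simps l_neg intro!: restrict_ext)
  qed (auto simp: std_module_simps PiE_iff extensional_def fun_eq_iff a_ac)
qed (auto simp: std_module_simps PiE_iff extensional_def fun_eq_iff l_distr r_distr m_assoc)

lemma abelian_group_std_module: "abelian_group (std_module R n)"
  using module_std_module by (rule module.axioms)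

lemma std_module_finsum:
  assumes "finite F" and "\<And>b. b \<in> F \<Longrightarrow> f b \<in> carrier (std_module R n)" and "j \<in> {1..n}"
  shows "(\<Oplus>\<^bsub>std_module R n\<^esub>b\<in>F. f b) j = (\<Oplus>b\<in>F. f b j)"
  using assms
proof (induction F)
  interpret M: module R "std_module R n" by (rule module_std_module)
  {
    case empty
    then show ?case by (simp add: std_module_simps)
  next
    case (insert b F)
    have "f \<in> F \<rightarrow> carrier (std_module R n)" "f b \<in> carrier (std_module R n)"
      using insert.prems(1) by auto
    moreover have "(\<lambda>b. f b j) \<in> F \<rightarrow> carrier R" "f b j \<in> carrier R"
      using insert.prems std_module_coord by auto
    ultimately show ?case
      using insert by (simp add: std_module_simps(3))
  }
qed

lemma std_module_expand:
  assumes v: "v \<in> carrier (std_module R n)"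
  shows "v = (\<Oplus>\<^bsub>std_module R n\<^esub>i\<in>{1..n}. v i \<odot>\<^bsub>std_module R n\<^esub> std_basis R n i)"
proof (rule std_module_eqI[OF v])
  interpret M: module R "std_module R n" by (rule module_std_module)
  have cl: "v i \<odot>\<^bsub>std_module R n\<^esub> std_basis R n i \<in> carrier (std_module R n)" if "i \<in> {1..n}" for i
    using std_module_coord[OF v that] std_basis_closed by simp
  show "(\<Oplus>\<^bsub>std_module R n\<^esub>i\<in>{1..n}. v i \<odot>\<^bsub>std_module R n\<^esub> std_basis R n i) \<in> carrier (std_module R n)"
    using cl by (intro M.M.finsum_closed) auto
  fix j assume j: "j \<in> {1..n}"
  have "(\<Oplus>\<^bsub>std_module R n\<^esub>i\<in>{1..n}. v i \<odot>\<^bsub>std_module R n\<^esub> std_basis R n i) j =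
      (\<Oplus>i\<in>{1..n}. if j = i then v i else \<zero>)"
    using j cl std_module_coord[OF v]
    by (subst std_module_finsum) (auto simp: smult_std_basis Pi_iff intro!: finsum_cong')
  also have "\<dots> = v j"
    using add.finprod_singleton[OF j, of v] std_module_coord[OF v] by (simp add: finsum_def Pi_iff)
  finally show "v j = (\<Oplus>\<^bsub>std_module R n\<^esub>i\<in>{1..n}. v i \<odot>\<^bsub>std_module R n\<^esub> std_basis R n i) j" ..
qed

end

section \<open>Additive maps and freeness of R^n\<close>

lemma (in abelian_group) additive_endo_finsum:
  assumes f: "additive_endo G f" and "finite F" and "h \<in> F \<rightarrow> carrier G"
  shows "f (\<Oplus>i\<in>F. h i) = (\<Oplus>i\<in>F. f (h i))"
  using assms(2,3)
proof (induction F)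
  case empty
  then show ?case using additive_endo_zero[OF f] by simp
next
  case (insert i F)
  then have "h \<in> F \<rightarrow> carrier G" "h i \<in> carrier G" "(\<lambda>i. f (h i)) \<in> F \<rightarrow> carrier G"
    using additive_endoD(1)[OF f] by auto
  with insert show ?case
    using additive_endoD[OF f] by (simp add: finsum_closed)
qed

text \<open>The maps of interest are only semilinear, so agreement is required on all multiples of
  the basis vectors, not just on the vectors themselves.\<close>

lemma (in cring) additive_endo_std_module_eq:
  assumes f: "additive_endo (std_module R n) f" and g: "additive_endo (std_module R n) g"
    and eq: "\<And>r i. r \<in> carrier R \<Longrightarrow> i \<in> {1..n} \<Longrightarrow>
      f (r \<odot>\<^bsub>std_module R n\<^esub> std_basis R n i) = g (r \<odot>\<^bsub>std_module R n\<^esub> std_basis R n i)"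
    and v: "v \<in> carrier (std_module R n)"
  shows "f v = g v"
proof -
  interpret M: module R "std_module R n" by (rule module_std_module)
  let ?h = "\<lambda>i. v i \<odot>\<^bsub>std_module R n\<^esub> std_basis R n i"
  have cl: "?h \<in> {1..n} \<rightarrow> carrier (std_module R n)"
    using std_module_coord[OF v] std_basis_closed by auto
  have "f v = (\<Oplus>\<^bsub>std_module R n\<^esub>i\<in>{1..n}. f (?h i))"
    using M.M.additive_endo_finsum[OF f _ cl] std_module_expand[OF v] by simp
  also have "\<dots> = (\<Oplus>\<^bsub>std_module R n\<^esub>i\<in>{1..n}. g (?h i))"
    using cl additive_endoD(1)[OF g] std_module_coord[OF v]
    by (intro M.M.finsum_cong') (auto simp: eq Pi_iff)
  also have "\<dots> = g v"
    using M.M.additive_endo_finsum[OF g _ cl] std_module_expand[OF v] by simp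
  finally show ?thesis .
qed

text \<open>Coordinate \<open>i\<close> tells the vectors apart because
  \<open>\<one> \<noteq> \<zero>\<close> in a domain.\<close>

lemma (in domain) inj_on_std_basis: "inj_on (std_basis R n) {1..n}"
proof (rule inj_onI)
  fix i j assume ij: "i \<in> {1..n}" "j \<in> {1..n}" "std_basis R n i = std_basis R n j"
  have "std_basis R n i i = \<one>" and "i \<noteq> j \<Longrightarrow> std_basis R n j i = \<zero>"
    using ij(1) by (simp_all add: std_basis_def)
  with ij(3) show "i = j" by auto
qed

lemma (in domain) std_module_linear_combination:
  assumes c: "c \<in> std_basis R n ` {1..n} \<rightarrow> carrier R"
  shows "(\<Oplus>\<^bsub>std_module R n\<^esub>b\<in>std_basis R n ` {1..n}. c b \<odot>\<^bsub>std_module R n\<^esub> b) =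
    (\<lambda>i\<in>{1..n}. c (std_basis R n i))"
proof -
  interpret M: module R "std_module R n" by (rule module_std_module)
  let ?v = "\<lambda>i\<in>{1..n}. c (std_basis R n i)"
  have "?v \<in> carrier (std_module R n)"
    using c by (auto simp: std_module_simps)
  note this[THEN std_module_expand]
  also have "(\<Oplus>\<^bsub>std_module R n\<^esub>i\<in>{1..n}. ?v i \<odot>\<^bsub>std_module R n\<^esub> std_basis R n i) =
      (\<Oplus>\<^bsub>std_module R n\<^esub>i\<in>{1..n}. c (std_basis R n i) \<odot>\<^bsub>std_module R n\<^esub> std_basis R n i)"
    using c std_basis_closed by (intro M.M.finsum_cong') (auto simp: Pi_iff)
  also have "\<dots> = (\<Oplus>\<^bsub>std_module R n\<^esub>b\<in>std_basis R n ` {1..n}. c b \<odot>\<^bsub>std_module R n\<^esub> b)"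
    using c std_basis_closed
    by (intro M.M.add.finprod_reindex[OF _ inj_on_std_basis, symmetric, folded finsum_def])
      (auto simp: Pi_iff)
  finally show ?thesis by simp
qed

text \<open>The standard basis works, with coordinates as coefficients. \<open>M\<close> is a
  separate record because the lemma is meant for \<open>V_module\<close> with restricted scalars,
  which agrees with \<open>std_module\<close> only in its additive monoid and in scalars on the
  carrier.\<close>

lemma (in domain) free_of_rank_std_module:
  assumes M: "add_monoid M = add_monoid (std_module R n)"
    and smult: "\<And>r v. r \<in> carrier R \<Longrightarrow> v \<in> carrier (std_module R n) \<Longrightarrow>
      r \<odot>\<^bsub>M\<^esub> v = r \<odot>\<^bsub>std_module R n\<^esub> v"
  shows "free_of_rank R M n"
proof -
  interpret S: module R "std_module R n" by (rule module_std_module)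
  have carrier: "carrier M = carrier (std_module R n)" and add: "add M = add (std_module R n)"
    using M by (simp_all add: fun_eq_iff)
  have finsum: "finsum M = finsum (std_module R n)"
    by (simp only: finsum_def M)
  have "abelian_group M"
    using S.M.abelian_group_axioms M
    by (simp add: abelian_group_def abelian_monoid_def abelian_group_axioms_def)
  then have "module R M"
    by (rule moduleI[OF is_cring]) (auto simp: carrier add smult S.smult_l_distr S.smult_r_distr
        S.smult_assoc1)
  moreover
  let ?B = "std_basis R n ` {1..n}"
  have "\<exists>!c. c \<in> ?B \<rightarrow>\<^sub>E carrier R \<and> v = (\<Oplus>\<^bsub>M\<^esub>b\<in>?B. c b \<odot>\<^bsub>M\<^esub> b)"
    if v: "v \<in> carrier M" for v
  proof -
    have *: "(\<Oplus>\<^bsub>M\<^esub>b\<in>?B. c b \<odot>\<^bsub>M\<^esub> b) = (\<lambda>i\<in>{1..n}. c (std_basis R n i))"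
      if c: "c \<in> ?B \<rightarrow>\<^sub>E carrier R" for c
    proof -
      have "(\<Oplus>\<^bsub>M\<^esub>b\<in>?B. c b \<odot>\<^bsub>M\<^esub> b) = (\<Oplus>\<^bsub>std_module R n\<^esub>b\<in>?B. c b \<odot>\<^bsub>std_module R n\<^esub> b)"
        unfolding finsum using c std_basis_closed
        by (intro S.M.finsum_cong') (auto simp: smult Pi_iff PiE_iff)
      also have "\<dots> = (\<lambda>i\<in>{1..n}. c (std_basis R n i))"
        using c by (intro std_module_linear_combination) (auto simp: PiE_iff)
      finally show ?thesis .
    qed
    \<comment> \<open>The coefficient at a basis vector is the coordinate with its index, recovered
      by inverting \<open>std_basis\<close>; the restriction gives membership in the extensional
      function space.\<close>
    define d where "d = (\<lambda>b\<in>?B. v (the_inv_into {1..n} (std_basis R n) b))"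
    have d_basis: "d (std_basis R n i) = v i" if "i \<in> {1..n}" for i
      using that the_inv_into_f_f[OF inj_on_std_basis that] unfolding d_def by simp
    have d: "d \<in> ?B \<rightarrow>\<^sub>E carrier R"
    proof (rule PiE_I)
      fix b assume "b \<in> ?B"
      then obtain i where "i \<in> {1..n}" "b = std_basis R n i" by blast
      then show "d b \<in> carrier R"
        using d_basis v std_module_coord unfolding carrier by simp
    qed (simp add: d_def)
    have "v = (\<lambda>i\<in>{1..n}. v i)"
      using v unfolding carrier std_module_simps by (simp only: PiE_restrict)
    also have "\<dots> = (\<lambda>i\<in>{1..n}. d (std_basis R n i))"
      by (rule restrict_ext) (simp only: d_basis)
    finally have v_eq: "v = (\<lambda>i\<in>{1..n}. d (std_basis R n i))" .
    show ?thesis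
    proof (rule ex1I[of _ d])
      show "d \<in> ?B \<rightarrow>\<^sub>E carrier R \<and> v = (\<Oplus>\<^bsub>M\<^esub>b\<in>?B. d b \<odot>\<^bsub>M\<^esub> b)"
        using d v_eq *[OF d] by simp
      fix c assume c: "c \<in> ?B \<rightarrow>\<^sub>E carrier R \<and> v = (\<Oplus>\<^bsub>M\<^esub>b\<in>?B. c b \<odot>\<^bsub>M\<^esub> b)"
      then have v_c: "v = (\<lambda>i\<in>{1..n}. c (std_basis R n i))"
        using * by simp
      show "c = d"
      proof (rule PiE_ext[OF conjunct1[OF c] d])
        fix b assume "b \<in> ?B"
        then obtain i where i: "i \<in> {1..n}" "b = std_basis R n i" by blast
        have "v i = c b"
          using i by (subst v_c) simp
        then show "c b = d b"
          using i d_basis by simp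
      qed
    qed
  qed
  moreover have "card ?B = n"
    using card_image[OF inj_on_std_basis, of n] by simp
  moreover have "?B \<subseteq> carrier M"
    using std_basis_closed carrier by blast
  ultimately show ?thesis
    unfolding free_of_rank_def by (intro conjI exI[of _ ?B]) auto
qed


section \<open>Powers of an automorphism and infinite orbits\<close>

lemma (in ring) ring_hom_restrict_inv_into:
  assumes "h \<in> ring_hom R R" and h: "h \<in> Bij (carrier R)"
  shows "restrict (inv_into (carrier R) h) (carrier R) \<in> ring_hom R R"
proof (rule ring_hom_memI)
  have bij: "bij_betw h (carrier R) (carrier R)"
    using h by (simp add: Bij_def)
  have one: "inv_into (carrier R) h \<one> = \<one>"
    using bij_betw_inv_into_left[OF bij one_closed] ring_hom_one[OF assms(1)] by simp
  then show "restrict (inv_into (carrier R) h) (carrier R) \<one> = \<one>"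
    by simp
next
  fix x y assume xy: "x \<in> carrier R" "y \<in> carrier R"
  show "restrict (inv_into (carrier R) h) (carrier R) (x \<otimes> y) =
      restrict (inv_into (carrier R) h) (carrier R) x \<otimes> restrict (inv_into (carrier R) h) (carrier R) y"
    using xy by (simp add: Bij_inv_into_lemma[OF _ h, of "monoid.mult R"] ring_hom_mult[OF assms(1)])
  show "restrict (inv_into (carrier R) h) (carrier R) (x \<oplus> y) =
      restrict (inv_into (carrier R) h) (carrier R) x \<oplus> restrict (inv_into (carrier R) h) (carrier R) y"
    using xy by (simp add: Bij_inv_into_lemma[OF _ h, of "add R"] ring_hom_add[OF assms(1)])
qed (simp add: Bij_inv_into_mem[OF h])

text \<open>Realised as a subgroup of \<open>BijGroup\<close>, which makes the laws of integer
  powers available for \<sigma>.\<close>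

lemma (in ring) group_ring_AutoGroup: "group (ring_AutoGroup R)"
  unfolding ring_AutoGroup_def
proof (intro subgroup.subgroup_is_group[OF _ group_BijGroup] subgroup.intro)
  fix f g assume f: "f \<in> ring_hom R R \<inter> Bij (carrier R)" and g: "g \<in> ring_hom R R \<inter> Bij (carrier R)"
  then have "compose (carrier R) f g \<in> ring_hom R R"
    by (intro ring_hom_memI) (auto simp: compose_def ring_hom_closed ring_hom_mult ring_hom_add ring_hom_one)
  with f g show "f \<otimes>\<^bsub>BijGroup (carrier R)\<^esub> g \<in> ring_hom R R \<inter> Bij (carrier R)"
    by (simp add: BijGroup_def compose_Bij)
next
  show "\<one>\<^bsub>BijGroup (carrier R)\<^esub> \<in> ring_hom R R \<inter> Bij (carrier R)"
    by (auto simp: BijGroup_def id_Bij intro!: ring_hom_memI)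
next
  fix f assume "f \<in> ring_hom R R \<inter> Bij (carrier R)"
  then show "inv\<^bsub>BijGroup (carrier R)\<^esub> f \<in> ring_hom R R \<inter> Bij (carrier R)"
    using ring_hom_restrict_inv_into by (simp add: inv_BijGroup restrict_inv_into_Bij)
qed (auto simp: BijGroup_def)

section \<open>Integer powers of \<sigma> and divisibility\<close>

locale domain_automorphism = principal_domain R for R (structure) +
  fixes \<sigma>
  assumes \<sigma>_auto: "\<sigma> \<in> carrier (ring_AutoGroup R)"
begin

abbreviation pow_\<sigma> :: "int \<Rightarrow> 'a \<Rightarrow> 'a" where
  "pow_\<sigma> k \<equiv> \<sigma> [^]\<^bsub>ring_AutoGroup R\<^esub> k"

lemma pow_\<sigma>_auto: "pow_\<sigma> k \<in> carrier (ring_AutoGroup R)"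
  using group.int_pow_closed[OF group_ring_AutoGroup \<sigma>_auto] .

lemma pow_\<sigma>_hom: "pow_\<sigma> k \<in> ring_hom R R" and pow_\<sigma>_Bij: "pow_\<sigma> k \<in> Bij (carrier R)"
  using pow_\<sigma>_auto by (auto simp: ring_AutoGroup_def)

lemma one_ring_AutoGroup_apply [simp]: "r \<in> carrier R \<Longrightarrow> \<one>\<^bsub>ring_AutoGroup R\<^esub> r = r"
  by (simp add: ring_AutoGroup_def BijGroup_def)

lemma pow_\<sigma>_1 [simp]: "pow_\<sigma> 1 = \<sigma>"
  using group.int_pow_1[OF group_ring_AutoGroup \<sigma>_auto] .

lemma pow_\<sigma>_minus_1: "pow_\<sigma> (- 1) = inv\<^bsub>ring_AutoGroup R\<^esub> \<sigma>"
  using group.int_pow_neg[OF group_ring_AutoGroup \<sigma>_auto, of 1] by simp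

lemma pow_\<sigma>_closed [simp]: "r \<in> carrier R \<Longrightarrow> pow_\<sigma> k r \<in> carrier R"
  using ring_hom_closed[OF pow_\<sigma>_hom] .

lemma pow_\<sigma>_one [simp]: "pow_\<sigma> k \<one> = \<one>"
  using ring_hom_one[OF pow_\<sigma>_hom] .

lemma pow_\<sigma>_zero [simp]: "pow_\<sigma> k \<zero> = \<zero>"
  using ring_hom_zero[OF pow_\<sigma>_hom] ring_axioms by blast

lemma pow_\<sigma>_mult [simp]:
  "r \<in> carrier R \<Longrightarrow> r' \<in> carrier R \<Longrightarrow> pow_\<sigma> k (r \<otimes> r') = pow_\<sigma> k r \<otimes> pow_\<sigma> k r'"
  using ring_hom_mult[OF pow_\<sigma>_hom] .

lemma pow_\<sigma>_add [simp]:
  "r \<in> carrier R \<Longrightarrow> r' \<in> carrier R \<Longrightarrow> pow_\<sigma> k (r \<oplus> r') = pow_\<sigma> k r \<oplus> pow_\<sigma> k r'"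
  using ring_hom_add[OF pow_\<sigma>_hom] .

lemma pow_\<sigma>_pow_\<sigma> [simp]:
  assumes "r \<in> carrier R"
  shows "pow_\<sigma> i (pow_\<sigma> j r) = pow_\<sigma> (i + j) r"
proof -
  have "pow_\<sigma> (i + j) = pow_\<sigma> i \<otimes>\<^bsub>ring_AutoGroup R\<^esub> pow_\<sigma> j"
    using group.int_pow_mult[OF group_ring_AutoGroup \<sigma>_auto] .
  then show ?thesis
    using assms pow_\<sigma>_Bij by (simp add: ring_AutoGroup_def BijGroup_def compose_def)
qed

text \<open>The last two rules absorb \<sigma> into neighbouring powers, so that composites
  normalise to a single \<open>pow_\<sigma>\<close> with an added exponent.\<close>

lemma \<sigma>_simps [simp]:
  "r \<in> carrier R \<Longrightarrow> \<sigma> r \<in> carrier R"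
  "\<sigma> \<zero> = \<zero>"
  "r \<in> carrier R \<Longrightarrow> r' \<in> carrier R \<Longrightarrow> \<sigma> (r \<otimes> r') = \<sigma> r \<otimes> \<sigma> r'"
  "r \<in> carrier R \<Longrightarrow> r' \<in> carrier R \<Longrightarrow> \<sigma> (r \<oplus> r') = \<sigma> r \<oplus> \<sigma> r'"
  "r \<in> carrier R \<Longrightarrow> \<sigma> (pow_\<sigma> i r) = pow_\<sigma> (1 + i) r"
  "r \<in> carrier R \<Longrightarrow> pow_\<sigma> i (\<sigma> r) = pow_\<sigma> (i + 1) r"
  using pow_\<sigma>_closed[of _ 1] pow_\<sigma>_zero[of 1] pow_\<sigma>_mult[of _ _ 1] pow_\<sigma>_add[of _ _ 1]
    pow_\<sigma>_pow_\<sigma>[of _ 1] pow_\<sigma>_pow_\<sigma>[of _ _ 1] by simp_all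

lemma pow_\<sigma>_eq_zero_iff [simp]:
  assumes "r \<in> carrier R"
  shows "pow_\<sigma> k r = \<zero> \<longleftrightarrow> r = \<zero>"
proof -
  have "pow_\<sigma> (- k) (pow_\<sigma> k r) = r"
    using assms by simp
  then show ?thesis by (metis pow_\<sigma>_zero)
qed

lemma pow_\<sigma>_divides:
  assumes "p \<in> carrier R" and "b \<in> carrier R" and "p divides b"
  shows "pow_\<sigma> k p divides pow_\<sigma> k b"
  using assms by (auto simp: factor_def)

text \<open>Apply \<sigma>^(-j), or \<sigma>^j in the other direction. All later movements along an
  orbit are exponent arithmetic with this rule.\<close>

lemma pow_\<sigma>_divides_iff:
  assumes "p \<in> carrier R" and "b \<in> carrier R"
  shows "pow_\<sigma> i p divides pow_\<sigma> j b \<longleftrightarrow> pow_\<sigma> (i - j) p divides b"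
  using pow_\<sigma>_divides[of "pow_\<sigma> i p" "pow_\<sigma> j b" "- j"]
    pow_\<sigma>_divides[of "pow_\<sigma> (i - j) p" b j] assms by auto

lemma pow_\<sigma>_associated_iff:
  assumes "p \<in> carrier R" and "b \<in> carrier R"
  shows "pow_\<sigma> i p \<sim> pow_\<sigma> j b \<longleftrightarrow> pow_\<sigma> (k + i) p \<sim> pow_\<sigma> (k + j) b"
  using assms by (simp add: associated_def pow_\<sigma>_divides_iff algebra_simps)

lemma pow_\<sigma>_Units:
  assumes "u \<in> Units R"
  shows "pow_\<sigma> k u \<in> Units R"
proof -
  obtain w where w: "w \<in> carrier R" "u \<otimes> w = \<one>"
    using assms Units_r_inv Units_inv_closed by blast
  then have "pow_\<sigma> k u \<otimes> pow_\<sigma> k w = \<one>"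
    using pow_\<sigma>_mult[of u w k] Units_closed[OF assms] by simp
  then have "pow_\<sigma> k u divides \<one>"
    unfolding factor_def using w by (intro bexI[of _ "pow_\<sigma> k w"]) simp_all
  then show ?thesis
    using divides_one Units_closed[OF assms] by simp
qed

lemma pow_\<sigma>_irreducible:
  assumes p: "p \<in> carrier R" "ring_irreducible p"
  shows "ring_irreducible (pow_\<sigma> k p)"
proof (rule ring_irreducibleI)
  have inv: "pow_\<sigma> (- k) (pow_\<sigma> k p) = p"
    using p by simp
  show "pow_\<sigma> k p \<in> carrier R - {\<zero>}"
    using p ring_irreducibleE(1)[OF p] by simp
  show "pow_\<sigma> k p \<notin> Units R"
    using pow_\<sigma>_Units[of "pow_\<sigma> k p" "- k"] ring_irreducibleE(4)[OF p] inv by auto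
  fix u v assume uv: "u \<in> carrier R" "v \<in> carrier R" "pow_\<sigma> k p = u \<otimes> v"
  then have "p = pow_\<sigma> (- k) u \<otimes> pow_\<sigma> (- k) v"
    using inv by simp
  then have "pow_\<sigma> (- k) u \<in> Units R \<or> pow_\<sigma> (- k) v \<in> Units R"
    using uv ring_irreducibleE(5)[OF p] by simp
  then show "u \<in> Units R \<or> v \<in> Units R"
    using pow_\<sigma>_Units[of "pow_\<sigma> (- k) u" k] pow_\<sigma>_Units[of "pow_\<sigma> (- k) v" k] uv by auto
qed

text \<open>In a principal ideal domain irreducible elements are prime.\<close>

lemma irreducible_divides_mult:
  assumes "p \<in> carrier R" "ring_irreducible p" and "u \<in> carrier R" "v \<in> carrier R"
    and "p divides u \<otimes> v"
  shows "p divides u \<or> p divides v"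
  using assms primeness_condition[of p] primeE[OF ring_primeE(3)[of p]] by metis

lemma irreducible_divides_irreducible:
  assumes "p \<in> carrier R" "ring_irreducible p" and "q \<in> carrier R" "ring_irreducible q"
    and "p divides q"
  shows "p \<sim> q"
  using divides_irreducible_condition[OF ring_irreducibleE(2)[OF assms(3,4)] assms(1,5)]
    ring_irreducibleE(4)[OF assms(1,2)] by blast

text \<open>Automorphisms preserve associatedness, so the union over representatives in
  \<open>class_action\<close> collapses to one class.\<close>

lemma class_action_assoc_class:
  assumes "p \<in> carrier R"
  shows "class_action R (pow_\<sigma> k) (assoc_class R p) = assoc_class R (pow_\<sigma> k p)"
proof
  have eq: "pow_\<sigma> k p \<sim> pow_\<sigma> k r" if "r \<in> carrier R" "p \<sim> r" for r
    using that assms pow_\<sigma>_divides by (simp add: associated_def)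
  show "class_action R (pow_\<sigma> k) (assoc_class R p) \<subseteq> assoc_class R (pow_\<sigma> k p)"
    using associated_trans[OF eq] assms
    by (auto simp: class_action_def eq_class_of_def)
  show "assoc_class R (pow_\<sigma> k p) \<subseteq> class_action R (pow_\<sigma> k) (assoc_class R p)"
    using assms by (auto simp: class_action_def eq_class_of_def)
qed

end

section \<open>Consequences of infinite orbits\<close>

locale infinite_orbits = domain_automorphism +
  assumes orbits: "\<forall>\<Omega> \<in> orbits (subgroup_generated (ring_AutoGroup R) {\<sigma>}) (Defs.Irr R) (class_action R).
    infinite \<Omega>"
begin

text \<open>An association between two powers would make the orbit of the class of \<open>p\<close>
  periodic, hence contained in a finite set of \<open>d\<close> classes.\<close>

lemma not_associated_pow_\<sigma>:
  assumes p: "p \<in> carrier R" "ring_irreducible p" and "i < j"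
  shows "\<not> pow_\<sigma> i p \<sim> pow_\<sigma> j p"
proof
  assume "pow_\<sigma> i p \<sim> pow_\<sigma> j p"
  define d where "d = j - i"
  have d: "d > 0" using \<open>i < j\<close> by (simp add: d_def)
  have step: "pow_\<sigma> k p \<sim> pow_\<sigma> (k + d) p" for k
    using \<open>pow_\<sigma> i p \<sim> pow_\<sigma> j p\<close> pow_\<sigma>_associated_iff[OF p(1) p(1), of i j "k - i"]
    by (simp add: d_def algebra_simps)
  have nat: "pow_\<sigma> k p \<sim> pow_\<sigma> (k + int m * d) p" for k m
  proof (induction m)
    case (Suc m)
    have "k + int m * d + d = k + int (Suc m) * d" by (simp add: algebra_simps)
    then show ?case
      using associated_trans[OF Suc step[of "k + int m * d"]] p(1) by (simp only: pow_\<sigma>_closed)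
  qed (use p in simp)
  \<comment> \<open>\<open>nat\<close> only climbs by multiples of \<open>d\<close>: for
    \<open>k \<ge> 0\<close> it leads from \<open>k mod d\<close> up to \<open>k\<close>, for
    negative \<open>k\<close> from \<open>k\<close> up to \<open>k mod d\<close>.\<close>
  have mod: "pow_\<sigma> (k mod d) p \<sim> pow_\<sigma> k p" for k
  proof (cases "k \<ge> 0")
    case True
    then have "k mod d + int (nat (k div d)) * d = k"
      using d by (simp add: pos_imp_zdiv_nonneg_iff)
    then show ?thesis using nat[of "k mod d" "nat (k div d)"] by simp
  next
    case False
    then have "k div d < 0"
      using d by (simp add: pos_imp_zdiv_neg_iff)
    then have "k + int (nat (- (k div d))) * d = k mod d"
      by (simp add: minus_div_mult_eq_mod)
    then show ?thesis
      using nat[of k "nat (- (k div d))"] p by (simp add: associated_sym)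
  qed
  let ?H = "subgroup_generated (ring_AutoGroup R) {\<sigma>}"
  let ?\<Omega> = "orbit ?H (class_action R) (assoc_class R p)"
  have "?\<Omega> \<in> orbits ?H (Defs.Irr R) (class_action R)"
    using p by (auto simp: orbits_def Defs.Irr_def)
  then have "infinite ?\<Omega>"
    using orbits by blast
  moreover have "?\<Omega> \<subseteq> (\<lambda>k. assoc_class R (pow_\<sigma> k p)) ` {0..<d}"
  proof
    fix C assume "C \<in> ?\<Omega>"
    then obtain k where "C = class_action R (pow_\<sigma> k) (assoc_class R p)"
      using group.carrier_subgroup_generated_by_singleton[OF group_ring_AutoGroup \<sigma>_auto]
      by (auto simp: orbit_def)
    then have "C = assoc_class R (pow_\<sigma> k p)"
      using class_action_assoc_class p by simp
    also have "\<dots> = assoc_class R (pow_\<sigma> (k mod d) p)"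
      using mod[of k] p by (auto simp: eq_class_of_def intro: associated_trans associated_sym)
    finally show "C \<in> (\<lambda>k. assoc_class R (pow_\<sigma> k p)) ` {0..<d}"
      using d by auto
  qed
  ultimately show False
    using finite_subset by blast
qed

lemma associated_pow_\<sigma>_iff:
  assumes p: "p \<in> carrier R" "ring_irreducible p"
  shows "pow_\<sigma> i p \<sim> pow_\<sigma> j p \<longleftrightarrow> i = j"
  using not_associated_pow_\<sigma>[OF p, of i j] not_associated_pow_\<sigma>[OF p, of j i] p
  by (metis associated_refl associated_sym linorder_neqE pow_\<sigma>_closed)

text \<open>Each such power is associated to one of the finitely many irreducible factors of
  \<open>b\<close>, and two different powers cannot share a factor because they are not
  associated.\<close>

lemma finite_pow_\<sigma>_divides:
  assumes p: "p \<in> carrier R" "ring_irreducible p" and b: "b \<in> carrier R" "b \<noteq> \<zero>"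
  shows "finite {k. pow_\<sigma> k p divides b}"
proof -
  \<comment> \<open>Factorisation is taken in \<open>mult_of R\<close>, the multiplicative monoid of
    nonzero elements.\<close>
  obtain fs where fs: "set fs \<subseteq> carrier (mult_of R)" "wfactors (mult_of R) fs b"
    using mult_of.wfactors_exist[of b] b by auto
  have "\<exists>f\<in>set fs. pow_\<sigma> k p \<sim> f" if k: "pow_\<sigma> k p divides b" for k
  proof -
    let ?q = "pow_\<sigma> k p"
    have q: "?q \<in> carrier R" "ring_irreducible ?q" "?q \<noteq> \<zero>"
      using p pow_\<sigma>_irreducible ring_irreducibleE(1) by auto
    have prime: "prime (mult_of R) ?q"
      using q primeness_condition ring_primeE(2) by blast
    have "b divides\<^bsub>mult_of R\<^esub> foldr (\<otimes>) fs \<one>"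
      using fs(2) by (simp add: wfactors_def associated_def)
    moreover have "?q divides\<^bsub>mult_of R\<^esub> b"
      using k q b by simp
    moreover have "?q \<in> carrier (mult_of R)"
      using q by simp
    ultimately have "?q divides\<^bsub>mult_of R\<^esub> foldr (\<otimes>) fs \<one>"
      using mult_of.divides_trans by blast
    then obtain i where i: "i < length fs" "?q divides\<^bsub>mult_of R\<^esub> fs ! i"
      using mult_of.multlist_prime_pos[OF prime _ fs(1)] q by auto
    have f: "fs ! i \<in> carrier R" "fs ! i \<noteq> \<zero>" "irreducible (mult_of R) (fs ! i)"
      using i(1) fs by (auto simp: wfactors_def dest: nth_mem)
    then show ?thesis
      using irreducible_divides_irreducible[OF q(1,2) f(1) ring_irreducibleI'[of "fs ! i"]] i by auto
  qed
  then obtain F where F: "\<And>k. pow_\<sigma> k p divides b \<Longrightarrow> F k \<in> set fs \<and> pow_\<sigma> k p \<sim> F k"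
    by metis
  have "inj_on F {k. pow_\<sigma> k p divides b}"
  proof (rule inj_onI)
    fix i j assume ij: "i \<in> {k. pow_\<sigma> k p divides b}" "j \<in> {k. pow_\<sigma> k p divides b}" "F i = F j"
    then have "pow_\<sigma> i p \<sim> F i" "pow_\<sigma> j p \<sim> F i" "F i \<in> carrier R"
      using F[of i] F[of j] fs(1) by (auto simp flip: ij(3))
    then have "pow_\<sigma> i p \<sim> pow_\<sigma> j p"
      using p by (meson associated_sym associated_trans pow_\<sigma>_closed)
    then show "i = j" using associated_pow_\<sigma>_iff[OF p] by simp
  qed
  moreover have "F ` {k. pow_\<sigma> k p divides b} \<subseteq> set fs"
    using F by auto
  ultimately show ?thesis
    using inj_on_finite finite_set by blast
qed

text \<open>Walking along the orbit in steps of \<open>m\<close> must leave the finite set of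
  divisors of \<open>b\<close>. Since \<open>m\<close> may be negative, the lemma serves for both
  ends of the orbit.\<close>

lemma last_pow_\<sigma>_divides:
  fixes m :: int
  assumes p: "p \<in> carrier R" "ring_irreducible p" and b: "b \<in> carrier R" "b \<noteq> \<zero>"
    and "m \<noteq> 0" and "p divides b"
  obtains l :: nat where "pow_\<sigma> (m * int l) p divides b" and "\<not> pow_\<sigma> (m * int (Suc l)) p divides b"
proof -
  have "\<exists>l. \<not> pow_\<sigma> (m * int l) p divides b"
  proof (rule ccontr)
    assume "\<not> ?thesis"
    then have "range (\<lambda>l::nat. m * int l) \<subseteq> {k. pow_\<sigma> k p divides b}" by auto
    moreover have "infinite (range (\<lambda>l::nat. m * int l))"
      using \<open>m \<noteq> 0\<close> by (intro range_inj_infinite injI) simp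
    ultimately show False
      using finite_pow_\<sigma>_divides[OF p b] finite_subset by blast
  qed
  then obtain l where "\<not> pow_\<sigma> (m * int l) p divides b" "\<forall>l'<l. pow_\<sigma> (m * int l') p divides b"
    using exists_least_iff[of "\<lambda>l. \<not> pow_\<sigma> (m * int l) p divides b"] by auto
  \<comment> \<open>The first exponent that fails is not 0, as \<open>p\<close> itself divides
    \<open>b\<close>; its predecessor is the one wanted.\<close>
  moreover have "l \<noteq> 0"
    using calculation(1) p(1) \<open>p divides b\<close> by (intro notI) simp
  then obtain l' where "l = Suc l'"
    using not0_implies_Suc by blast
  ultimately show ?thesis
    using that[of l'] by blast
qed

end


section \<open>The action of the generalized Weyl algebra on \<open>R\<^sup>n\<close>\<close>

lemma V_module_simps [simp]:
  "carrier (V_module R n act) = carrier (std_module R n)"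
  "\<zero>\<^bsub>V_module R n act\<^esub> = \<zero>\<^bsub>std_module R n\<^esub>"
  "add (V_module R n act) = add (std_module R n)"
  "smult (V_module R n act) = act"
  by (simp_all add: V_module_def)

lemma a_inv_V_module: "a_inv (V_module R n act) = a_inv (std_module R n)"
  by (simp add: a_inv_def m_inv_def fun_eq_iff)

text \<open>Evaluation sees only the additive structure, which \<open>V_module\<close> shares with
  \<open>std_module\<close>; facts about operators on R^n therefore carry over.\<close>

lemma expr_action_V_module:
  "expr_action (V_module R n act) \<phi> s v = expr_action (std_module R n) \<phi> s v"
  by (induction s arbitrary: v) (simp_all add: a_inv_V_module)

lemma additive_endo_V_module:
  "additive_endo (V_module R n act) f \<longleftrightarrow> additive_endo (std_module R n) f"
  by (simp add: additive_endo_def)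

lemma (in cring) abelian_group_V_module: "abelian_group (V_module R n act)"
proof -
  interpret S: abelian_group "std_module R n" by (rule abelian_group_std_module)
  show ?thesis
  proof (rule abelian_groupI)
    show "\<exists>v\<in>carrier (V_module R n act). v \<oplus>\<^bsub>V_module R n act\<^esub> u = \<zero>\<^bsub>V_module R n act\<^esub>"
      if "u \<in> carrier (V_module R n act)" for u
      using that S.l_neg[of u] S.a_inv_closed[of u] by auto
  qed (simp_all add: S.a_ac)
qed

lemma (in domain) exact_quotient_mult:
  assumes "q \<in> carrier R" "d \<in> carrier R" "d \<noteq> \<zero>"
  shows "exact_quotient R (q \<otimes> d) d = q"
  unfolding exact_quotient_def using assms m_rcancel by (intro the_equality) auto

text \<open>The data from which the action is constructed; what simplicity requires on top is added
  in \<open>simple_setting\<close>.\<close>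

locale V_setting = domain_automorphism +
  fixes a a\<^sub>0 :: 'a and n :: nat
  assumes a_closed [simp]: "a \<in> carrier R"
    and a\<^sub>0_closed [simp]: "a\<^sub>0 \<in> carrier R" and a\<^sub>0_nonzero: "a\<^sub>0 \<noteq> \<zero>"
    and a\<^sub>0_divides_a: "a\<^sub>0 divides a" and n_pos: "n \<ge> 1"
begin

abbreviation M where "M \<equiv> std_module R n"

abbreviation e where "e \<equiv> std_basis R n"

definition c where "c = exact_quotient R a a\<^sub>0"

lemma c_closed [simp]: "c \<in> carrier R" and c_a\<^sub>0: "a = c \<otimes> a\<^sub>0"
proof -
  obtain q where "q \<in> carrier R" "a = a\<^sub>0 \<otimes> q"
    using a\<^sub>0_divides_a by (auto simp: factor_def)
  then have "q \<in> carrier R" "a = q \<otimes> a\<^sub>0"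
    by (simp_all add: m_comm)
  moreover from this have "c = q"
    unfolding c_def using exact_quotient_mult[of q a\<^sub>0] a\<^sub>0_nonzero by simp
  ultimately show "c \<in> carrier R" "a = c \<otimes> a\<^sub>0" by simp_all
qed

lemma exact_quotient_a:
  assumes "r \<in> carrier R"
  shows "exact_quotient R (r \<otimes> a) a\<^sub>0 = r \<otimes> c"
  using exact_quotient_mult[of "r \<otimes> c" a\<^sub>0] assms a\<^sub>0_nonzero c_a\<^sub>0 by (simp add: m_assoc)

text \<open>The operators of x and y read off by coordinates: coordinate \<open>j\<close> of
  \<open>\<xi> v\<close> comes from the preceding basis vector, that of \<open>\<eta> v\<close> from
  the following one, cyclically. The wrap-around is tested first, which also covers
  \<open>n = 1\<close>.\<close>

definition \<xi> :: "(nat \<Rightarrow> 'a) \<Rightarrow> nat \<Rightarrow> 'a" where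
  "\<xi> v = (\<lambda>j\<in>{1..n}. if j = 1 then a\<^sub>0 \<otimes> pow_\<sigma> (- 1) (v n) else pow_\<sigma> (- 1) (v (j - 1)))"

definition \<eta> :: "(nat \<Rightarrow> 'a) \<Rightarrow> nat \<Rightarrow> 'a" where
  "\<eta> v = (\<lambda>j\<in>{1..n}. if j = n then \<sigma> (c \<otimes> v 1) else \<sigma> (a \<otimes> v (j + 1)))"

lemma coord_closed:
  assumes "v \<in> carrier M" and "1 \<le> j" and "j \<le> n"
  shows "v j \<in> carrier R"
  using std_module_coord[OF assms(1), of j] assms by simp

lemma \<xi>_closed:
  assumes v: "v \<in> carrier M"
  shows "\<xi> v \<in> carrier M"
  using n_pos coord_closed[OF v] by (auto simp: \<xi>_def std_module_simps(1))

lemma \<eta>_closed: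
  assumes v: "v \<in> carrier M"
  shows "\<eta> v \<in> carrier M"
  using n_pos coord_closed[OF v] by (auto simp: \<eta>_def std_module_simps(1))

lemma smult_M_closed: "r \<in> carrier R \<Longrightarrow> v \<in> carrier M \<Longrightarrow> r \<odot>\<^bsub>M\<^esub> v \<in> carrier M"
  by (rule module.smult_closed[OF module_std_module])

lemma \<xi>_additive: "additive_endo M \<xi>"
proof (rule additive_endoI)
  fix u v assume uv: "u \<in> carrier M" "v \<in> carrier M"
  note cl = coord_closed[OF uv(1)] coord_closed[OF uv(2)]
  show "\<xi> (u \<oplus>\<^bsub>M\<^esub> v) = \<xi> u \<oplus>\<^bsub>M\<^esub> \<xi> v"
    using n_pos cl
    by (auto simp: \<xi>_def std_module_simps(3) r_distr intro!: restrict_ext)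
qed (rule \<xi>_closed)

lemma \<eta>_additive: "additive_endo M \<eta>"
proof (rule additive_endoI)
  fix u v assume uv: "u \<in> carrier M" "v \<in> carrier M"
  note cl = coord_closed[OF uv(1)] coord_closed[OF uv(2)]
  show "\<eta> (u \<oplus>\<^bsub>M\<^esub> v) = \<eta> u \<oplus>\<^bsub>M\<^esub> \<eta> v"
    using n_pos cl
    by (auto simp: \<eta>_def std_module_simps(3) r_distr intro!: restrict_ext)
qed (rule \<eta>_closed)

lemma smult_additive: "r \<in> carrier R \<Longrightarrow> additive_endo M (smult M r)"
  using module_std_module[of n]
  by (intro additive_endoI) (simp_all add: smult_M_closed module.smult_r_distr)

lemma \<xi>_smult:
  assumes "r \<in> carrier R" and v: "v \<in> carrier M"
  shows "\<xi> (\<sigma> r \<odot>\<^bsub>M\<^esub> v) = r \<odot>\<^bsub>M\<^esub> \<xi> v"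
  using n_pos assms(1) coord_closed[OF v]
  by (auto simp: \<xi>_def std_module_simps(4) m_lcomm intro!: restrict_ext)

lemma \<eta>_smult:
  assumes "r \<in> carrier R" and v: "v \<in> carrier M"
  shows "\<eta> (r \<odot>\<^bsub>M\<^esub> v) = \<sigma> r \<odot>\<^bsub>M\<^esub> \<eta> v"
  using n_pos assms(1) coord_closed[OF v]
  by (auto simp: \<eta>_def std_module_simps(4) m_lcomm intro!: restrict_ext)

text \<open>The relation xy = a. Away from coordinate 1 the automorphisms cancel; at coordinate 1
  the factors \<open>a\<^sub>0\<close> and \<open>c\<close> recombine to \<open>a\<close>.\<close>

lemma \<xi>_\<eta>:
  assumes v: "v \<in> carrier M"
  shows "\<xi> (\<eta> v) = a \<odot>\<^bsub>M\<^esub> v"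
proof -
  have "a\<^sub>0 \<otimes> (c \<otimes> v 1) = a \<otimes> v 1"
    using coord_closed[OF v, of 1] n_pos m_lcomm[of a\<^sub>0 c] m_assoc[of c a\<^sub>0]
    by (simp flip: c_a\<^sub>0)
  then show ?thesis
    using n_pos coord_closed[OF v]
    by (auto simp: \<xi>_def \<eta>_def std_module_simps(4) simp del: pow_\<sigma>_mult \<sigma>_simps(3)
        intro!: restrict_ext)
qed

text \<open>The relation yx = \<sigma>(a); here the two factors recombine at coordinate
  \<open>n\<close>.\<close>

lemma \<eta>_\<xi>:
  assumes v: "v \<in> carrier M"
  shows "\<eta> (\<xi> v) = \<sigma> a \<odot>\<^bsub>M\<^esub> v"
proof -
  have "\<sigma> c \<otimes> \<sigma> a\<^sub>0 = \<sigma> a"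
    using \<sigma>_simps(3)[of c a\<^sub>0] by (simp flip: c_a\<^sub>0)
  then have "\<sigma> (c \<otimes> (a\<^sub>0 \<otimes> pow_\<sigma> (- 1) (v n))) = \<sigma> a \<otimes> v n"
    using coord_closed[OF v, of n] n_pos m_assoc[of "\<sigma> c" "\<sigma> a\<^sub>0" "v n", symmetric] by simp
  then show ?thesis
    using n_pos coord_closed[OF v]
    by (auto simp: \<xi>_def \<eta>_def std_module_simps(4) intro!: restrict_ext)
qed

lemma \<xi>_e:
  assumes r: "r \<in> carrier R"
  shows "1 \<le> i \<Longrightarrow> i < n \<Longrightarrow> \<xi> (r \<odot>\<^bsub>M\<^esub> e i) = pow_\<sigma> (- 1) r \<odot>\<^bsub>M\<^esub> e (i + 1)"
    and "\<xi> (r \<odot>\<^bsub>M\<^esub> e n) = (a\<^sub>0 \<otimes> pow_\<sigma> (- 1) r) \<odot>\<^bsub>M\<^esub> e 1"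
  using r n_pos by (auto simp: smult_std_basis \<xi>_def intro!: restrict_ext)

lemma \<eta>_e:
  assumes r: "r \<in> carrier R"
  shows "2 \<le> i \<Longrightarrow> i \<le> n \<Longrightarrow> \<eta> (r \<odot>\<^bsub>M\<^esub> e i) = \<sigma> (a \<otimes> r) \<odot>\<^bsub>M\<^esub> e (i - 1)"
    and "\<eta> (r \<odot>\<^bsub>M\<^esub> e 1) = \<sigma> (r \<otimes> c) \<odot>\<^bsub>M\<^esub> e n"
  using r n_pos by (auto simp: smult_std_basis \<eta>_def m_comm[of c] intro!: restrict_ext)

primrec gen_action :: "'a gwa_gen \<Rightarrow> (nat \<Rightarrow> 'a) \<Rightarrow> nat \<Rightarrow> 'a" where
  "gen_action (Coef r) = smult M r"
| "gen_action GenX = \<xi>"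
| "gen_action GenY = \<eta>"

lemma gen_action_additive: "g \<in> gwa_gens R \<Longrightarrow> additive_endo M (gen_action g)"
  by (auto simp: gwa_gens_def \<xi>_additive \<eta>_additive smult_additive)

text \<open>The three families for \<open>Coef\<close> are laws of the R-module R^n; the other four
  are the semilinearity of \<open>\<xi>\<close> and \<open>\<eta>\<close> and their two
  composites.\<close>

lemma gen_action_rels:
  assumes "(s, t) \<in> gwa_rels R \<sigma> a" and v: "v \<in> carrier M"
  shows "expr_action M gen_action s v = expr_action M gen_action t v"
proof -
  interpret M: module R M by (rule module_std_module)
  show ?thesis
    using assms
    by cases (simp_all add: M.smult_l_distr M.smult_assoc1 \<xi>_smult \<eta>_smult \<xi>_\<eta> \<eta>_\<xi>)
qed

text \<open>Trades the formulas on multiples of basis vectors for operators on all of R^n. A module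
  structure makes x and y act additively, and additive maps are determined by those multiples; hence
  the case split on the first two conjuncts.\<close>

lemma V_action_iff:
  "V_action R \<sigma> a a\<^sub>0 n act \<longleftrightarrow>
    act \<in> carrier (gwa R \<sigma> a) \<rightarrow>\<^sub>E carrier M \<rightarrow>\<^sub>E carrier M \<and>
    left_module (gwa R \<sigma> a) (V_module R n act) \<and>
    (\<forall>g\<in>gwa_gens R. \<forall>v\<in>carrier M.
      act (ring_cong (gwa_gens R) (gwa_rels R \<sigma> a) `` {Gen g}) v = gen_action g v)"
    (is "?L \<longleftrightarrow> ?A \<and> ?B \<and> ?C")
proof (cases "?A \<and> ?B")
  case True
  then interpret left_module "gwa R \<sigma> a" "V_module R n act" by simp
  let ?x = "gwa_x R \<sigma> a" and ?y = "gwa_y R \<sigma> a"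
  have xy: "?x \<in> carrier (gwa R \<sigma> a)" "?y \<in> carrier (gwa R \<sigma> a)"
    by (simp_all add: gwa_def gwa_x_def gwa_y_def presented_ring_closed gwa_gens_def)
  have add: "additive_endo M (act ?x)" "additive_endo M (act ?y)"
    using additive_endo_smult[OF xy(1)] additive_endo_smult[OF xy(2)]
    by (simp_all add: additive_endo_V_module)
  \<comment> \<open>Each decomposition isolates the index at which the operator wraps around:
    \<open>n\<close> for x and 1 for y.\<close>
  have split: "{1..n} = insert n {1..<n}" "{1..n} = insert 1 {2..n}"
    using n_pos by auto
  have x: "(\<forall>v\<in>carrier M. act ?x v = \<xi> v) \<longleftrightarrow>
      (\<forall>r\<in>carrier R. \<forall>i\<in>{1..n}. act ?x (r \<odot>\<^bsub>M\<^esub> e i) = \<xi> (r \<odot>\<^bsub>M\<^esub> e i))"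
    using additive_endo_std_module_eq[OF add(1) \<xi>_additive] smult_M_closed std_basis_closed by blast
  have y: "(\<forall>v\<in>carrier M. act ?y v = \<eta> v) \<longleftrightarrow>
      (\<forall>r\<in>carrier R. \<forall>i\<in>{1..n}. act ?y (r \<odot>\<^bsub>M\<^esub> e i) = \<eta> (r \<odot>\<^bsub>M\<^esub> e i))"
    using additive_endo_std_module_eq[OF add(2) \<eta>_additive] smult_M_closed std_basis_closed by blast
  have C: "?C \<longleftrightarrow> (\<forall>r\<in>carrier R. \<forall>v\<in>carrier M. act (gwa_coef R \<sigma> a r) v = r \<odot>\<^bsub>M\<^esub> v) \<and>
      (\<forall>v\<in>carrier M. act ?x v = \<xi> v) \<and> (\<forall>v\<in>carrier M. act ?y v = \<eta> v)"
    by (auto simp: gwa_gens_def gwa_coef_def gwa_x_def gwa_y_def)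
  have x': "(\<forall>v\<in>carrier M. act ?x v = \<xi> v) \<longleftrightarrow>
      (\<forall>r\<in>carrier R. (\<forall>i\<in>{1..<n}. act ?x (r \<odot>\<^bsub>M\<^esub> e i) = pow_\<sigma> (- 1) r \<odot>\<^bsub>M\<^esub> e (i + 1)) \<and>
        act ?x (r \<odot>\<^bsub>M\<^esub> e n) = (a\<^sub>0 \<otimes> pow_\<sigma> (- 1) r) \<odot>\<^bsub>M\<^esub> e 1)"
    unfolding x split(1) using \<xi>_e by (auto simp del: One_nat_def)
  have y': "(\<forall>v\<in>carrier M. act ?y v = \<eta> v) \<longleftrightarrow>
      (\<forall>r\<in>carrier R. (\<forall>i\<in>{2..n}. act ?y (r \<odot>\<^bsub>M\<^esub> e i) = \<sigma> (a \<otimes> r) \<odot>\<^bsub>M\<^esub> e (i - 1)) \<and>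
        act ?y (r \<odot>\<^bsub>M\<^esub> e 1) = \<sigma> (exact_quotient R (r \<otimes> a) a\<^sub>0) \<odot>\<^bsub>M\<^esub> e n)"
    unfolding y split(2) using \<eta>_e exact_quotient_a by (auto simp del: One_nat_def \<sigma>_simps(3))
  show ?thesis
    using True unfolding C x' y' unfolding V_action_def Let_def pow_\<sigma>_minus_1 by blast
next
  case False
  then show ?thesis by (auto simp: V_action_def Let_def)
qed

lemma V_action_exists: "\<exists>act. V_action R \<sigma> a a\<^sub>0 n act"
proof -
  obtain act where act: "act \<in> carrier (gwa R \<sigma> a) \<rightarrow>\<^sub>E carrier M \<rightarrow>\<^sub>E carrier M"
      and eq: "\<And>s v. s \<in> ring_exprs (gwa_gens R) \<Longrightarrow> v \<in> carrier M \<Longrightarrow>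
        act (ring_cong (gwa_gens R) (gwa_rels R \<sigma> a) `` {s}) v = expr_action M gen_action s v"
    using left_module_presented_ring_exists[where S = "gwa_gens R" and P = "gwa_rels R \<sigma> a"
        and \<phi> = gen_action, OF abelian_group_std_module gen_action_additive gen_action_rels]
    unfolding gwa_def by blast
  have "left_module (gwa R \<sigma> a) (V_module R n act)"
    unfolding gwa_def
  proof (rule left_module_presented_ringI[where \<phi> = gen_action, OF abelian_group_V_module])
    show "additive_endo (V_module R n act) (gen_action g)" if "g \<in> gwa_gens R" for g
      using gen_action_additive[OF that] by (simp add: additive_endo_V_module)
    show "ring_cong (gwa_gens R) (gwa_rels R \<sigma> a) `` {s} \<odot>\<^bsub>V_module R n act\<^esub> v =
        expr_action (V_module R n act) gen_action s v"
      if "s \<in> ring_exprs (gwa_gens R)" "v \<in> carrier (V_module R n act)" for s v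
      using eq that by (simp add: expr_action_V_module)
  qed
  then show ?thesis
    using act eq by (auto simp: V_action_iff intro!: exI[of _ act])
qed

lemma V_action_expr:
  assumes act: "V_action R \<sigma> a a\<^sub>0 n act"
    and s: "s \<in> ring_exprs (gwa_gens R)" and v: "v \<in> carrier M"
  shows "act (ring_cong (gwa_gens R) (gwa_rels R \<sigma> a) `` {s}) v = expr_action M gen_action s v"
proof -
  let ?c = "\<lambda>s. ring_cong (gwa_gens R) (gwa_rels R \<sigma> a) `` {s}"
  have "left_module (presented_ring (gwa_gens R) (gwa_rels R \<sigma> a)) (V_module R n act)"
    using act by (simp add: V_action_iff gwa_def)
  then have "act (?c s) v = expr_action M (\<lambda>g. act (?c (Gen g))) s v"
    using left_module_presented_ring_smult[OF _ s, of _ "V_module R n act" v] v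
    by (simp add: expr_action_V_module)
  also have "\<dots> = expr_action M gen_action s v"
    using act
    by (intro expr_action_fun_cong[OF abelian_group_std_module gen_action_additive _ s v, symmetric])
      (simp_all add: V_action_iff)
  finally show ?thesis .
qed

text \<open>Every element of the algebra is the class of an expression, whose action is forced by
  the generators; extensionality in both arguments then gives equality of functions.\<close>

lemma V_action_unique:
  assumes "V_action R \<sigma> a a\<^sub>0 n act" and "V_action R \<sigma> a a\<^sub>0 n act'"
  shows "act = act'"
proof -
  have "act C v = act' C v" if C: "C \<in> carrier (gwa R \<sigma> a)" and v: "v \<in> carrier M" for C v
  proof -
    obtain s where "s \<in> ring_exprs (gwa_gens R)"
        "C = ring_cong (gwa_gens R) (gwa_rels R \<sigma> a) `` {s}"
      using C unfolding gwa_def by (rule presented_ring_carrierE)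
    then show ?thesis
      using V_action_expr[OF assms(1) _ v] V_action_expr[OF assms(2) _ v] by simp
  qed
  moreover have "act \<in> carrier (gwa R \<sigma> a) \<rightarrow>\<^sub>E carrier M \<rightarrow>\<^sub>E carrier M"
      "act' \<in> carrier (gwa R \<sigma> a) \<rightarrow>\<^sub>E carrier M \<rightarrow>\<^sub>E carrier M"
    using assms by (simp_all add: V_action_iff)
  ultimately show ?thesis
    by (intro PiE_ext[of act _ "\<lambda>_. carrier M \<rightarrow>\<^sub>E carrier M" act'] PiE_ext[of _ "carrier M" "\<lambda>_. carrier M"])
      (auto simp: PiE_mem)
qed

lemma free_of_rank_V_module:
  assumes "V_action R \<sigma> a a\<^sub>0 n act"
  shows "free_of_rank R (restrict_scalars (gwa_coef R \<sigma> a) (V_module R n act)) n"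
proof (rule free_of_rank_std_module)
  show "add_monoid (restrict_scalars (gwa_coef R \<sigma> a) (V_module R n act)) = add_monoid M"
    by (simp add: restrict_scalars_def)
  show "r \<odot>\<^bsub>restrict_scalars (gwa_coef R \<sigma> a) (V_module R n act)\<^esub> v = r \<odot>\<^bsub>M\<^esub> v"
    if "r \<in> carrier R" "v \<in> carrier M" for r v
    using assms that by (simp add: restrict_scalars_def V_action_def Let_def)
qed

end


section \<open>Simplicity\<close>

context V_setting
begin

text \<open>The factor that coordinate \<open>i\<close> acquires under x^n: \<open>a\<^sub>0\<close>
  enters at coordinate 1 and undergoes \<open>i - 1\<close> further shifts by \<sigma>^(-1).\<close>

abbreviation twist :: "nat \<Rightarrow> 'a" where
  "twist i \<equiv> pow_\<sigma> (1 - int i) a\<^sub>0"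

text \<open>After \<open>k\<close> steps exactly the coordinates \<open>i \<le> k\<close> hold
  entries that have wrapped around. The bound \<open>k \<le> n\<close> means that no entry wraps
  twice and that the subtractions are not truncated.\<close>

lemma \<xi>_funpow:
  assumes v: "v \<in> carrier M" and "k \<le> n"
  shows "(\<xi> ^^ k) v = (\<lambda>i\<in>{1..n}. if i \<le> k then twist i \<otimes> pow_\<sigma> (- int k) (v (i + n - k))
    else pow_\<sigma> (- int k) (v (i - k)))"
  using \<open>k \<le> n\<close>
proof (induction k)
  case 0
  have "v = (\<lambda>i\<in>{1..n}. v i)"
    using v unfolding std_module_simps by (simp only: PiE_restrict)
  also have "\<dots> = (\<lambda>i\<in>{1..n}. if i \<le> 0 then twist i \<otimes> pow_\<sigma> (- int 0) (v (i + n - 0))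
      else pow_\<sigma> (- int 0) (v (i - 0)))"
    using coord_closed[OF v] by (intro restrict_ext) simp
  finally show ?case by simp
next
  case (Suc k)
  have cl: "v j \<in> carrier R" if "1 \<le> j" "j \<le> n" for j
    using coord_closed[OF v that] .
  define w where "w = (\<xi> ^^ k) v"
  have w: "w j = (if j \<le> k then twist j \<otimes> pow_\<sigma> (- int k) (v (j + n - k))
      else pow_\<sigma> (- int k) (v (j - k)))" if "1 \<le> j" "j \<le> n" for j
    using Suc that by (simp add: w_def)
  have "\<xi> w = (\<lambda>i\<in>{1..n}. if i \<le> Suc k then twist i \<otimes> pow_\<sigma> (- int (Suc k)) (v (i + n - Suc k))
      else pow_\<sigma> (- int (Suc k)) (v (i - Suc k)))"
    unfolding \<xi>_def
  proof (rule restrict_ext)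
    fix j assume "j \<in> {1..n}"
    then have j: "1 \<le> j" "j \<le> n" by auto
    show "(if j = 1 then a\<^sub>0 \<otimes> pow_\<sigma> (- 1) (w n) else pow_\<sigma> (- 1) (w (j - 1))) =
        (if j \<le> Suc k then twist j \<otimes> pow_\<sigma> (- int (Suc k)) (v (j + n - Suc k))
         else pow_\<sigma> (- int (Suc k)) (v (j - Suc k)))"
    proof (cases "j = 1")
      case True
      then show ?thesis
        using Suc.prems n_pos w[of n] cl[of "n - k"] by simp
    next
      case False
      then obtain j' where j': "j = Suc j'" "1 \<le> j'" "j' \<le> n"
        using j by (cases j) auto
      have "j' + n - k \<le> n" "1 \<le> j' + n - k" if "j' \<le> k"
        using that Suc.prems j' by auto
      moreover have "1 \<le> j' - k" "j' - k \<le> n" if "\<not> j' \<le> k"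
        using that j' by auto
      ultimately show ?thesis
        using j' w[of j'] cl[of "j' + n - k"] cl[of "j' - k"] by simp
    qed
  qed
  then show ?case by (simp add: w_def)
qed

lemma \<xi>_funpow_n:
  assumes v: "v \<in> carrier M" and i: "i \<in> {1..n}"
  shows "(\<xi> ^^ n) v i = twist i \<otimes> pow_\<sigma> (- int n) (v i)"
  using \<xi>_funpow[OF v, of n] i by simp

end

section \<open>Arithmetic of the twisted relation\<close>

locale simple_setting = V_setting + infinite_orbits +
  assumes a_nonzero: "a \<noteq> \<zero>" and a\<^sub>0_irreducible: "ring_irreducible a\<^sub>0"
    and a\<^sub>0_minimal: "\<And>k::nat. k > 0 \<Longrightarrow> \<not> pow_\<sigma> (- int k) a\<^sub>0 divides a"
begin

lemma irreducible_not_divides_unit: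
  assumes "p \<in> carrier R" "ring_irreducible p" and "u \<in> Units R"
  shows "\<not> p divides u"
  using assms divides_unit ring_irreducibleE(4) by blast

lemma pow_\<sigma>_associated_shift:
  assumes "p \<in> carrier R" "q \<in> carrier R" "pow_\<sigma> i p \<sim> pow_\<sigma> j q"
  shows "p \<sim> pow_\<sigma> (j - i) q"
  using pow_\<sigma>_associated_iff[OF assms(1,2), of i j "- i"] assms by (simp add: algebra_simps)

lemma twist_irreducible: "ring_irreducible (twist i)"
  using pow_\<sigma>_irreducible[OF _ a\<^sub>0_irreducible] by simp

text \<open>Divide by a gcd. It is a combination of \<open>r\<close> and \<open>s\<close>, so
  cancelling it leaves a Bezout identity for \<open>u\<close> and \<open>w\<close>, which excludes a
  common irreducible factor.\<close>

lemma coprime_quotients: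
  assumes "r \<in> carrier R" "s \<in> carrier R" "r \<noteq> \<zero>"
  obtains g u w where "g \<in> carrier R" "u \<in> carrier R" "w \<in> carrier R" "g \<noteq> \<zero>"
    "r = g \<otimes> u" "s = g \<otimes> w"
    "\<And>p. p \<in> carrier R \<Longrightarrow> ring_irreducible p \<Longrightarrow> p divides u \<Longrightarrow> \<not> p divides w"
proof -
  obtain g where g: "g \<in> carrier R" "PIdl g = PIdl r <+>\<^bsub>R\<^esub> PIdl s"
    using exists_gen[OF add_ideals[OF cgenideal_ideal[OF assms(1)] cgenideal_ideal[OF assms(2)]]]
    by metis
  then have "g gcdof r s"
    using ideal_sum_iff_gcd[OF assms(1,2) g(1)] by simp
  then obtain u w where uw: "u \<in> carrier R" "w \<in> carrier R" "r = g \<otimes> u" "s = g \<otimes> w"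
    by (auto simp: isgcd_def factor_def)
  have "g \<in> PIdl r <+>\<^bsub>R\<^esub> PIdl s"
    using cgenideal_self[OF g(1)] g(2) by simp
  then obtain x y where xy: "x \<in> carrier R" "y \<in> carrier R" "g = x \<otimes> r \<oplus> y \<otimes> s"
    by (auto simp: set_add_def' cgenideal_def)
  have "g \<noteq> \<zero>"
    using assms(3) uw by auto
  have "g \<otimes> \<one> = g \<otimes> (x \<otimes> u \<oplus> y \<otimes> w)"
    using xy uw g(1) by (subst xy(3)) (simp add: r_distr m_lcomm del: r_one, simp)
  then have bezout: "\<one> = x \<otimes> u \<oplus> y \<otimes> w"
    using m_lcancel[OF \<open>g \<noteq> \<zero>\<close> g(1) one_closed, of "x \<otimes> u \<oplus> y \<otimes> w"] xy(1,2) uw(1,2)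
    by (simp del: r_one)
  have "\<not> p divides w" if p: "p \<in> carrier R" "ring_irreducible p" "p divides u" for p
  proof
    assume "p divides w"
    then obtain u' w' where "u' \<in> carrier R" "w' \<in> carrier R" "u = p \<otimes> u'" "w = p \<otimes> w'"
      using p(3) by (auto simp: factor_def)
    then have "\<one> = p \<otimes> (x \<otimes> u' \<oplus> y \<otimes> w')"
      using bezout xy(1,2) p(1) by (simp add: r_distr m_lcomm)
    then have "p divides \<one>"
      using \<open>u' \<in> carrier R\<close> \<open>w' \<in> carrier R\<close> xy(1,2) by (auto simp: factor_def)
    then show False
      using divides_one p ring_irreducibleE(4) by blast
  qed
  with that[OF g(1) uw(1,2) \<open>g \<noteq> \<zero>\<close> uw(3,4)] show ?thesis by blast
qed

text \<open>Follow an irreducible factor of \<open>u\<close> along its \<sigma>^n-orbit. The last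
  member dividing \<open>u\<close> in the forward direction must divide \<open>twist i\<close>; the
  first member no longer dividing \<open>u\<close> in the backward direction must divide
  \<open>twist j\<close>. Comparing exponents makes \<open>j - i\<close> a positive multiple of
  \<open>n\<close>, impossible for indices in \<open>{1..n}\<close>.\<close>

lemma twisted_relation_unit:
  assumes u: "u \<in> carrier R" "u \<noteq> \<zero>" and w: "w \<in> carrier R"
    and coprime: "\<And>p. p \<in> carrier R \<Longrightarrow> ring_irreducible p \<Longrightarrow> p divides u \<Longrightarrow> \<not> p divides w"
    and ij: "i \<in> {1..n}" "j \<in> {1..n}"
    and rel: "u \<otimes> (twist j \<otimes> pow_\<sigma> (- int n) w) = w \<otimes> (twist i \<otimes> pow_\<sigma> (- int n) u)"
  shows "u \<in> Units R"
proof (rule ccontr)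
  assume "u \<notin> Units R"
  moreover have "u \<in> carrier R - {\<zero>}"
    using u by simp
  ultimately obtain p where p: "p \<in> carrier R" "ring_irreducible p" "p divides u"
    using exists_irreducible_divisor by blast
  obtain l where l: "pow_\<sigma> (int n * int l) p divides u" "\<not> pow_\<sigma> (int n * int (Suc l)) p divides u"
    using last_pow_\<sigma>_divides[OF p(1,2) u _ p(3), of "int n"] n_pos by auto
  let ?q = "pow_\<sigma> (int n * int l) p"
  have q: "?q \<in> carrier R" "ring_irreducible ?q"
    using p pow_\<sigma>_irreducible by auto
  have "?q divides u \<otimes> (twist j \<otimes> pow_\<sigma> (- int n) w)"
    using divides_prod_r[OF l(1)] q u w by simp
  then have "?q divides w \<or> ?q divides twist i \<or> ?q divides pow_\<sigma> (- int n) u"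
    unfolding rel using irreducible_divides_mult[OF q] u w by (metis m_closed pow_\<sigma>_closed a\<^sub>0_closed)
  moreover have "\<not> ?q divides w"
    using coprime[OF q l(1)] .
  \<comment> \<open>Otherwise the next member of the orbit would still divide \<open>u\<close>,
    against the choice of \<open>l\<close>.\<close>
  moreover have "\<not> ?q divides pow_\<sigma> (- int n) u"
  proof -
    have "int n * int l - (- int n) = int n * int (Suc l)"
      by (simp add: algebra_simps)
    then show ?thesis
      using l(2) pow_\<sigma>_divides_iff[OF p(1) u(1), of "int n * int l" "- int n"] by simp
  qed
  ultimately have "?q \<sim> twist i"
    using irreducible_divides_irreducible[OF q _ twist_irreducible] by simp
  then have p1: "p \<sim> pow_\<sigma> (1 - int i - int n * int l) a\<^sub>0"
    using pow_\<sigma>_associated_shift p(1) by simp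
  obtain l' where l': "pow_\<sigma> (- int n * int l') p divides u"
      "\<not> pow_\<sigma> (- int n * int (Suc l')) p divides u"
    using last_pow_\<sigma>_divides[OF p(1,2) u _ p(3), of "- int n"] n_pos by auto
  define q' where "q' = pow_\<sigma> (- int n * int l') p"
  \<comment> \<open>One step past the backward end: \<open>q''\<close> does not divide
    \<open>u\<close>, yet it divides \<sigma>^(-n)(u) and hence both sides of the relation.\<close>
  define q'' where "q'' = pow_\<sigma> (- int n * int (Suc l')) p"
  have q': "q' \<in> carrier R" "ring_irreducible q'" and q'': "q'' \<in> carrier R" "ring_irreducible q''"
    using p pow_\<sigma>_irreducible unfolding q'_def q''_def by auto
  have "- int n + - int n * int l' = - int n * int (Suc l')"
    by (simp add: algebra_simps)
  then have q_eq: "q'' = pow_\<sigma> (- int n) q'"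
    using pow_\<sigma>_pow_\<sigma>[OF p(1), of "- int n" "- int n * int l'"]
    unfolding q'_def q''_def by simp
  have q'_u: "q' divides u" and q''_u: "\<not> q'' divides u"
    using l' unfolding q'_def q''_def by simp_all
  have "q'' divides pow_\<sigma> (- int n) u"
    unfolding q_eq using pow_\<sigma>_divides[OF q'(1) u(1) q'_u] .
  then have "q'' divides w \<otimes> (twist i \<otimes> pow_\<sigma> (- int n) u)"
    using q'' u w by (intro divides_prod_l[OF _ _ _ divides_prod_l]) simp_all
  then have "q'' divides u \<or> q'' divides twist j \<or> q'' divides pow_\<sigma> (- int n) w"
    unfolding rel[symmetric] using irreducible_divides_mult[OF q''] u w
    by (metis m_closed pow_\<sigma>_closed a\<^sub>0_closed)
  moreover have "\<not> q'' divides pow_\<sigma> (- int n) w"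
    using coprime[OF q' q'_u] pow_\<sigma>_divides_iff[of q' w "- int n" "- int n"] q' w q_eq by simp
  ultimately have "q'' \<sim> twist j"
    using q''_u irreducible_divides_irreducible[OF q'' _ twist_irreducible] by simp
  then have p2: "p \<sim> pow_\<sigma> (1 - int j + int n * int (Suc l')) a\<^sub>0"
    using pow_\<sigma>_associated_shift[OF p(1) a\<^sub>0_closed] unfolding q''_def by fastforce
  have "pow_\<sigma> (1 - int i - int n * int l) a\<^sub>0 \<sim> pow_\<sigma> (1 - int j + int n * int (Suc l')) a\<^sub>0"
    using p1 p2 p(1) by (meson associated_sym associated_trans pow_\<sigma>_closed a\<^sub>0_closed)
  then have "1 - int i - int n * int l = 1 - int j + int n * int (Suc l')"
    using associated_pow_\<sigma>_iff[OF a\<^sub>0_closed a\<^sub>0_irreducible] by simp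
  then have "int j - int i = int n * int (l + Suc l')"
    by (simp add: algebra_simps)
  moreover have "int n * int (l + Suc l') \<ge> int n"
    using n_pos by (simp add: algebra_simps)
  ultimately show False
    using ij by auto
qed

text \<open>After division by a gcd both quotients are units, by
  \<open>twisted_relation_unit\<close> and its mirror image. The relation then makes
  \<open>twist i\<close> and \<open>twist j\<close> associated, so their exponents agree.\<close>

lemma twisted_relation_eq:
  assumes r: "r \<in> carrier R" "r \<noteq> \<zero>" and s: "s \<in> carrier R" "s \<noteq> \<zero>"
    and ij: "i \<in> {1..n}" "j \<in> {1..n}"
    and rel: "r \<otimes> (twist j \<otimes> pow_\<sigma> (- int n) s) = s \<otimes> (twist i \<otimes> pow_\<sigma> (- int n) r)"
  shows "i = j"
proof -
  obtain g u w where g: "g \<in> carrier R" "g \<noteq> \<zero>" and uw: "u \<in> carrier R" "w \<in> carrier R"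
    and eq: "r = g \<otimes> u" "s = g \<otimes> w"
    and coprime: "\<And>p. p \<in> carrier R \<Longrightarrow> ring_irreducible p \<Longrightarrow> p divides u \<Longrightarrow> \<not> p divides w"
    using coprime_quotients[OF r(1) s(1) r(2)] by metis
  have nz: "u \<noteq> \<zero>" "w \<noteq> \<zero>"
    using r s g eq by auto
  \<comment> \<open>Both sides are homogeneous: replacing \<open>r\<close> and \<open>s\<close> by
    multiples of \<open>g\<close> produces the same factor on each side.\<close>
  have "(g \<otimes> pow_\<sigma> (- int n) g) \<otimes> (u \<otimes> (twist j \<otimes> pow_\<sigma> (- int n) w)) =
      (g \<otimes> pow_\<sigma> (- int n) g) \<otimes> (w \<otimes> (twist i \<otimes> pow_\<sigma> (- int n) u))"
    using rel g(1) uw unfolding eq by (simp add: m_ac)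
  moreover have "g \<otimes> pow_\<sigma> (- int n) g \<noteq> \<zero>"
    using g by (simp add: integral_iff)
  ultimately have rel': "u \<otimes> (twist j \<otimes> pow_\<sigma> (- int n) w) = w \<otimes> (twist i \<otimes> pow_\<sigma> (- int n) u)"
    using g(1) uw m_lcancel[of "g \<otimes> pow_\<sigma> (- int n) g"] by simp
  have "u \<in> Units R"
    using twisted_relation_unit[OF uw(1) nz(1) uw(2) coprime ij rel'] .
  moreover have "w \<in> Units R"
    using twisted_relation_unit[OF uw(2) nz(2) uw(1) _ ij(2,1) rel'[symmetric]] coprime by blast
  ultimately have units: "w \<in> Units R" "pow_\<sigma> (- int n) u \<in> Units R"
    using pow_\<sigma>_Units by auto
  have "twist j divides u \<otimes> (twist j \<otimes> pow_\<sigma> (- int n) w)"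
    using uw by (intro divides_prod_l[OF _ _ _ divides_prod_r]) simp_all
  then have "twist j divides w \<or> twist j divides twist i \<or> twist j divides pow_\<sigma> (- int n) u"
    unfolding rel' using irreducible_divides_mult[OF _ twist_irreducible] uw
    by (metis m_closed pow_\<sigma>_closed a\<^sub>0_closed)
  then have "twist j divides twist i"
    using units irreducible_not_divides_unit[OF _ twist_irreducible] by auto
  then have "twist j \<sim> twist i"
    using irreducible_divides_irreducible[OF _ twist_irreducible _ twist_irreducible] by simp
  then show "i = j"
    using associated_pow_\<sigma>_iff[OF a\<^sub>0_closed a\<^sub>0_irreducible] by simp
qed

end


text \<open>Submodules seen inside R^n: closure under R, \<open>\<xi>\<close> and
  \<open>\<eta>\<close> stands in for closure under the whole algebra.\<close>

locale simple_setting_submodule = simple_setting +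
  fixes N
  assumes N_subset: "N \<subseteq> carrier M" and N_zero: "\<zero>\<^bsub>M\<^esub> \<in> N"
    and N_add: "u \<in> N \<Longrightarrow> v \<in> N \<Longrightarrow> u \<oplus>\<^bsub>M\<^esub> v \<in> N"
    and N_smult: "r \<in> carrier R \<Longrightarrow> v \<in> N \<Longrightarrow> r \<odot>\<^bsub>M\<^esub> v \<in> N"
    and N_\<xi>: "v \<in> N \<Longrightarrow> \<xi> v \<in> N" and N_\<eta>: "v \<in> N \<Longrightarrow> \<eta> v \<in> N"
begin

lemma N_\<xi>_funpow: "v \<in> N \<Longrightarrow> (\<xi> ^^ k) v \<in> N"
  by (induction k) (simp_all add: N_\<xi>)

definition supp :: "(nat \<Rightarrow> 'a) \<Rightarrow> nat set" where
  "supp v = {i\<in>{1..n}. v i \<noteq> \<zero>}"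

lemma finite_supp: "finite (supp v)"
  by (simp add: supp_def)

lemma supp_empty_iff:
  assumes "v \<in> carrier M"
  shows "supp v = {} \<longleftrightarrow> v = \<zero>\<^bsub>M\<^esub>"
proof
  assume "supp v = {}"
  then show "v = \<zero>\<^bsub>M\<^esub>"
    using N_zero N_subset by (intro std_module_eqI[OF assms]) (auto simp: supp_def std_module_simps(2))
qed (auto simp: supp_def std_module_simps(2))

lemma minimal_support_singleton:
  assumes v: "v \<in> N" "v \<noteq> \<zero>\<^bsub>M\<^esub>"
    and min: "\<And>w. w \<in> N \<Longrightarrow> w \<noteq> \<zero>\<^bsub>M\<^esub> \<Longrightarrow> card (supp v) \<le> card (supp w)"
    and i: "i \<in> supp v" and j: "j \<in> supp v"
  shows "i = j"
proof -
  have vM: "v \<in> carrier M" using v N_subset by blast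
  have i': "i \<in> {1..n}" "v i \<noteq> \<zero>" and j': "j \<in> {1..n}" "v j \<noteq> \<zero>"
    using i j by (auto simp: supp_def)
  have cl: "v k \<in> carrier R" if "k \<in> {1..n}" for k
    using std_module_coord[OF vM that] .
  let ?s = "pow_\<sigma> (- int n)"
  \<comment> \<open>Elimination: the coefficients are chosen so that coordinate \<open>i\<close>
    cancels, while x^n creates no new nonzero coordinates.\<close>
  define w where "w = v i \<odot>\<^bsub>M\<^esub> (\<xi> ^^ n) v \<oplus>\<^bsub>M\<^esub> \<ominus> (twist i \<otimes> ?s (v i)) \<odot>\<^bsub>M\<^esub> v"
  have w: "w \<in> N"
    unfolding w_def using v cl[OF i'(1)] by (intro N_add N_smult N_\<xi>_funpow) simp_all
  have w_coord: "w k = v i \<otimes> (twist k \<otimes> ?s (v k)) \<ominus> v k \<otimes> (twist i \<otimes> ?s (v i))" if k: "k \<in> {1..n}" for k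
    using k cl[OF k] cl[OF i'(1)] \<xi>_funpow_n[OF vM k] n_pos
    by (simp add: w_def std_module_simps(3,4) minus_eq l_minus m_comm[of "v k"])
  have "supp w \<subseteq> supp v - {i}"
  proof
    fix k assume "k \<in> supp w"
    then have k: "k \<in> {1..n}" "w k \<noteq> \<zero>" by (auto simp: supp_def)
    have "w k = \<zero>" if "v k = \<zero>"
      using that k(1) cl[OF i'(1)] by (simp add: w_coord)
    moreover have "w i = \<zero>"
      using i'(1) cl[OF i'(1)] by (simp add: w_coord)
    ultimately show "k \<in> supp v - {i}"
      using k by (auto simp: supp_def)
  qed
  then have "card (supp w) < card (supp v)"
    using i finite_supp by (intro psubset_card_mono) auto
  then have "w = \<zero>\<^bsub>M\<^esub>"
    using min[OF w] by force
  \<comment> \<open>Coordinate \<open>j\<close> of the vanishing combination is precisely the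
    twisted relation between \<open>v i\<close> and \<open>v j\<close>.\<close>
  then have "w j = \<zero>"
    using j'(1) by (simp add: std_module_simps(2))
  then have "v i \<otimes> (twist j \<otimes> ?s (v j)) = v j \<otimes> (twist i \<otimes> ?s (v i))"
    using cl[OF i'(1)] cl[OF j'(1)] w_coord[OF j'(1)] by (simp add: r_right_minus_eq)
  then show "i = j"
    using twisted_relation_eq[OF cl[OF i'(1)] i'(2) cl[OF j'(1)] j'(2) i'(1) j'(1)] by simp
qed

lemma smult_e_mem:
  assumes "N \<noteq> {\<zero>\<^bsub>M\<^esub>}"
  obtains r i where "r \<in> carrier R" "r \<noteq> \<zero>" "i \<in> {1..n}" "r \<odot>\<^bsub>M\<^esub> e i \<in> N"
proof -
  have "\<exists>v. v \<in> N \<and> v \<noteq> \<zero>\<^bsub>M\<^esub>"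
    using assms N_zero by blast
  then obtain v where v: "v \<in> N" "v \<noteq> \<zero>\<^bsub>M\<^esub>"
    and min: "\<And>w. w \<in> N \<and> w \<noteq> \<zero>\<^bsub>M\<^esub> \<Longrightarrow> card (supp v) \<le> card (supp w)"
    using ex_has_least_nat[of "\<lambda>v. v \<in> N \<and> v \<noteq> \<zero>\<^bsub>M\<^esub>" _ "\<lambda>v. card (supp v)"] by blast
  have vM: "v \<in> carrier M" using v N_subset by blast
  obtain i where i: "i \<in> supp v"
    using v supp_empty_iff[OF vM] by blast
  then have i': "i \<in> {1..n}" "v i \<noteq> \<zero>" by (auto simp: supp_def)
  have vi: "v i \<in> carrier R" using std_module_coord[OF vM i'(1)] .
  have "v k = \<zero>" if "k \<in> {1..n}" "k \<noteq> i" for k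
    using minimal_support_singleton[OF v min i, of k] that by (auto simp: supp_def)
  then have "v = v i \<odot>\<^bsub>M\<^esub> e i"
    using i' vi
    by (intro std_module_eqI[OF vM smult_M_closed[OF vi std_basis_closed]]) (auto simp: smult_std_basis)
  then show ?thesis
    using that[OF vi i'(2,1)] v(1) by simp
qed

lemma shift_up:
  assumes "r \<in> carrier R" "r \<odot>\<^bsub>M\<^esub> e i \<in> N" "1 \<le> i" "i + k \<le> n"
  shows "pow_\<sigma> (- int k) r \<odot>\<^bsub>M\<^esub> e (i + k) \<in> N"
  using assms(4)
proof (induction k)
  case 0
  then show ?case using assms by simp
next
  case (Suc k)
  then have "\<xi> (pow_\<sigma> (- int k) r \<odot>\<^bsub>M\<^esub> e (i + k)) \<in> N"
    by (intro N_\<xi>) simp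
  then show ?case
    using \<xi>_e(1)[of "pow_\<sigma> (- int k) r" "i + k"] Suc.prems assms(1,3) by simp
qed

text \<open>Apply x exactly \<open>n - i + 1\<close> times: \<open>n - i\<close> shifts up to
  \<open>e n\<close>, then one step around to \<open>e 1\<close>.\<close>

lemma wrap_around:
  assumes "r \<in> carrier R" "r \<odot>\<^bsub>M\<^esub> e i \<in> N" "i \<in> {1..n}"
  shows "(a\<^sub>0 \<otimes> pow_\<sigma> (int i - int n - 1) r) \<odot>\<^bsub>M\<^esub> e 1 \<in> N"
proof -
  have "pow_\<sigma> (- int (n - i)) r \<odot>\<^bsub>M\<^esub> e n \<in> N"
    using shift_up[OF assms(1,2), of "n - i"] assms(3) by simp
  then have "\<xi> (pow_\<sigma> (- int (n - i)) r \<odot>\<^bsub>M\<^esub> e n) \<in> N"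
    by (rule N_\<xi>)
  moreover have "- 1 + - int (n - i) = int i - int n - 1"
    using assms(3) by simp
  ultimately show ?thesis
    using \<xi>_e(2)[of "pow_\<sigma> (- int (n - i)) r"] assms(1) pow_\<sigma>_pow_\<sigma>[OF assms(1), of "- 1" "- int (n - i)"]
    by simp
qed

text \<open>Apply y exactly \<open>k + 1\<close> times. The accumulated factor is D = \<sigma>(a)
  ... \<sigma>^k(a) \<sigma>^(k+1)(c), and \<open>c\<close> divides \<open>a\<close>; only the
  resulting bound on its irreducible factors is recorded.\<close>

lemma shift_down:
  assumes "b \<in> carrier R" "b \<odot>\<^bsub>M\<^esub> e 1 \<in> N" "k < n"
  obtains D where "D \<in> carrier R" "(D \<otimes> pow_\<sigma> (int (Suc k)) b) \<odot>\<^bsub>M\<^esub> e (n - k) \<in> N"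
    "\<And>q. q \<in> carrier R \<Longrightarrow> ring_irreducible q \<Longrightarrow> q divides D \<Longrightarrow>
      \<exists>i\<in>{1..Suc k}. q divides pow_\<sigma> (int i) a"
proof -
  have "\<exists>D\<in>carrier R. (D \<otimes> pow_\<sigma> (int (Suc k)) b) \<odot>\<^bsub>M\<^esub> e (n - k) \<in> N \<and>
    (\<forall>q\<in>carrier R. ring_irreducible q \<longrightarrow> q divides D \<longrightarrow> (\<exists>i\<in>{1..Suc k}. q divides pow_\<sigma> (int i) a))"
    using \<open>k < n\<close>
  proof (induction k)
    case 0
    have "\<eta> (b \<odot>\<^bsub>M\<^esub> e 1) \<in> N" by (rule N_\<eta>) fact
    then have "(\<sigma> c \<otimes> pow_\<sigma> (int (Suc 0)) b) \<odot>\<^bsub>M\<^esub> e (n - 0) \<in> N"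
      using assms(1) \<eta>_e(2)[of b] by (simp add: m_comm)
    moreover have "q divides pow_\<sigma> (int 1) a" if "q \<in> carrier R" "q divides \<sigma> c" for q
    proof -
      have "q divides \<sigma> c \<otimes> \<sigma> a\<^sub>0"
        using that by (intro divides_prod_r) simp_all
      then show ?thesis
        using \<sigma>_simps(3)[of c a\<^sub>0] by (simp flip: c_a\<^sub>0)
    qed
    ultimately show ?case
      by (intro bexI[of _ "\<sigma> c"]) (auto intro!: bexI[of _ 1])
  next
    case (Suc k)
    then obtain D where D: "D \<in> carrier R" "(D \<otimes> pow_\<sigma> (int (Suc k)) b) \<odot>\<^bsub>M\<^esub> e (n - k) \<in> N"
      and D_div: "\<And>q. q \<in> carrier R \<Longrightarrow> ring_irreducible q \<Longrightarrow> q divides D \<Longrightarrow>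
        \<exists>i\<in>{1..Suc k}. q divides pow_\<sigma> (int i) a"
      by auto
    let ?D = "\<sigma> a \<otimes> \<sigma> D"
    have "\<sigma> (a \<otimes> (D \<otimes> pow_\<sigma> (int (Suc k)) b)) = ?D \<otimes> pow_\<sigma> (int (Suc (Suc k))) b"
      using D(1) assms(1) by (simp add: m_assoc)
    then have "(?D \<otimes> pow_\<sigma> (int (Suc (Suc k))) b) \<odot>\<^bsub>M\<^esub> e (n - Suc k) \<in> N"
      using \<eta>_e(1)[of "D \<otimes> pow_\<sigma> (int (Suc k)) b" "n - k"] N_\<eta>[OF D(2)] D(1) assms(1) Suc.prems
      by (simp only: m_closed pow_\<sigma>_closed diff_diff_left) simp
    moreover have "\<exists>i\<in>{1..Suc (Suc k)}. q divides pow_\<sigma> (int i) a"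
      if q: "q \<in> carrier R" "ring_irreducible q" "q divides ?D" for q
    proof -
      consider "q divides \<sigma> a" | "q divides \<sigma> D"
        using irreducible_divides_mult[OF q(1,2) _ _ q(3)] D(1) by auto
      then show ?thesis
      proof cases
        case 1
        then show ?thesis by (intro bexI[of _ 1]) simp_all
      next
        case 2
        then have "pow_\<sigma> (- 1) q divides D"
          using pow_\<sigma>_divides_iff[OF q(1) D(1), of 0 1] q(1) by simp
        then obtain i where i: "i \<in> {1..Suc k}" "pow_\<sigma> (- 1) q divides pow_\<sigma> (int i) a"
          using D_div[of "pow_\<sigma> (- 1) q"] q pow_\<sigma>_irreducible by auto
        then have "q divides pow_\<sigma> (int (Suc i)) a"
          using pow_\<sigma>_divides[OF _ _ i(2), of 1] q(1) by (simp add: algebra_simps)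
        then show ?thesis
          using i(1) by (intro bexI[of _ "Suc i"]) auto
      qed
    qed
    ultimately show ?case
      using D(1) by (intro bexI[of _ ?D]) auto
  qed
  then show ?thesis using that by blast
qed

definition coeff_ideal :: "'a set" where
  "coeff_ideal = {r\<in>carrier R. r \<odot>\<^bsub>M\<^esub> e 1 \<in> N}"

lemma ideal_coeff_ideal: "ideal coeff_ideal R"
proof (rule idealI[OF ring_axioms])
  interpret M: module R M by (rule module_std_module)
  have mult: "r \<otimes> s \<in> coeff_ideal" if "s \<in> coeff_ideal" "r \<in> carrier R" for r s
    using that N_smult std_basis_closed by (auto simp: coeff_ideal_def M.smult_assoc1)
  then show "r \<otimes> s \<in> coeff_ideal" if "s \<in> coeff_ideal" "r \<in> carrier R" for r s
    using that .
  show "s \<otimes> r \<in> coeff_ideal" if "s \<in> coeff_ideal" "r \<in> carrier R" for r s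
    using mult[OF that] that by (simp add: m_comm coeff_ideal_def)
  have "\<ominus> r \<in> coeff_ideal" if "r \<in> coeff_ideal" for r
    using mult[OF that, of "\<ominus> \<one>"] that by (simp add: coeff_ideal_def l_minus)
  moreover have "\<zero> \<in> coeff_ideal"
    using N_zero std_basis_closed by (simp add: coeff_ideal_def)
  ultimately show "subgroup coeff_ideal (add_monoid R)"
    using N_add std_basis_closed
    by (intro group.subgroupI[OF add.is_group])
      (auto simp: coeff_ideal_def M.smult_l_distr a_inv_def[symmetric])
qed

text \<open>One full turn with x and one with y lead back to \<open>e 1\<close>, giving the
  divisibilities \<open>up\<close> and \<open>down\<close>. They control the two ends of the orbit
  of any irreducible factor of \<open>b\<close>, and together contradict the minimality of
  \<open>a\<^sub>0\<close>.\<close>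

lemma coeff_ideal_generator_unit:
  assumes b: "b \<in> carrier R" "b \<noteq> \<zero>" and gen: "coeff_ideal = PIdl b"
  shows "b \<in> Units R"
proof (rule ccontr)
  have b_divides: "b divides r" if "r \<in> carrier R" "r \<odot>\<^bsub>M\<^esub> e 1 \<in> N" for r
  proof -
    have "r \<in> PIdl b"
      using that by (simp add: coeff_ideal_def flip: gen)
    then show ?thesis
      using b(1) by (auto simp: cgenideal_def factor_def m_comm)
  qed
  have b_N: "b \<odot>\<^bsub>M\<^esub> e 1 \<in> N"
    using cgenideal_self[OF b(1)] by (simp add: coeff_ideal_def flip: gen)
  have up: "b divides a\<^sub>0 \<otimes> pow_\<sigma> (- int n) b"
    using b_divides wrap_around[OF b(1) b_N] b(1) n_pos by simp
  \<comment> \<open>With \<open>k = n - 1\<close> the descent ends at \<open>e 1\<close> again, and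
    the power of \<sigma> on \<open>b\<close> is \<open>n\<close>.\<close>
  obtain D where D: "D \<in> carrier R" "(D \<otimes> pow_\<sigma> (int n) b) \<odot>\<^bsub>M\<^esub> e 1 \<in> N"
    and D_div: "\<And>q. q \<in> carrier R \<Longrightarrow> ring_irreducible q \<Longrightarrow> q divides D \<Longrightarrow>
      \<exists>i\<in>{1..n}. q divides pow_\<sigma> (int i) a"
    using shift_down[OF b(1) b_N, of "n - 1"] n_pos by (auto simp del: One_nat_def)
  have down: "b divides D \<otimes> pow_\<sigma> (int n) b"
    using b_divides D b(1) by simp
  \<comment> \<open>The forward end of the orbit divides \<open>b\<close> but not \<sigma>^(-n)(b),
    so by \<open>up\<close> it divides \<open>a\<^sub>0\<close>.\<close>
  have orbit: "\<exists>l::nat. p \<sim> pow_\<sigma> (- int n * int l) a\<^sub>0"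
    if p: "p \<in> carrier R" "ring_irreducible p" "p divides b" for p
  proof -
    obtain l where l: "pow_\<sigma> (int n * int l) p divides b" "\<not> pow_\<sigma> (int n * int (Suc l)) p divides b"
      using last_pow_\<sigma>_divides[OF p(1,2) b _ p(3), of "int n"] n_pos by auto
    define q where "q = pow_\<sigma> (int n * int l) p"
    have q: "q \<in> carrier R" "ring_irreducible q"
      using p pow_\<sigma>_irreducible by (simp_all add: q_def)
    have "int n * int l - (- int n) = int n * int (Suc l)"
      by (simp add: algebra_simps)
    then have "\<not> q divides pow_\<sigma> (- int n) b"
      using l(2) pow_\<sigma>_divides_iff[OF p(1) b(1), of "int n * int l" "- int n"] by (simp add: q_def)
    moreover have "q divides a\<^sub>0 \<otimes> pow_\<sigma> (- int n) b"
      using divides_trans[OF _ up q(1)] l(1) by (simp add: q_def)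
    ultimately have "q divides a\<^sub>0"
      using irreducible_divides_mult[OF q, of a\<^sub>0 "pow_\<sigma> (- int n) b"] b(1) by simp
    then have "pow_\<sigma> (int n * int l) p \<sim> pow_\<sigma> 0 a\<^sub>0"
      using irreducible_divides_irreducible[OF q a\<^sub>0_closed a\<^sub>0_irreducible] by (simp add: q_def)
    then show ?thesis
      using pow_\<sigma>_associated_shift[OF p(1) a\<^sub>0_closed, of "int n * int l" 0] by auto
  qed
  assume "b \<notin> Units R"
  moreover have "b \<in> carrier R - {\<zero>}" using b by simp
  ultimately obtain p where p: "p \<in> carrier R" "ring_irreducible p" "p divides b"
    using exists_irreducible_divisor by blast
  \<comment> \<open>Now the backward end: it cannot divide \<sigma>^n(b), so \<open>down\<close>
    puts it among the factors of \<open>D\<close>.\<close>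
  obtain l where l: "pow_\<sigma> (- int n * int l) p divides b" "\<not> pow_\<sigma> (- int n * int (Suc l)) p divides b"
    using last_pow_\<sigma>_divides[OF p(1,2) b _ p(3), of "- int n"] n_pos by auto
  define q where "q = pow_\<sigma> (- int n * int l) p"
  have q: "q \<in> carrier R" "ring_irreducible q" "q divides b"
    using p l(1) pow_\<sigma>_irreducible by (simp_all add: q_def)
  have "- int n * int l - int n = - int n * int (Suc l)"
    by (simp add: algebra_simps)
  then have "\<not> q divides pow_\<sigma> (int n) b"
    using l(2) pow_\<sigma>_divides_iff[OF p(1) b(1), of "- int n * int l" "int n"] by (simp add: q_def)
  moreover have "q divides D \<otimes> pow_\<sigma> (int n) b"
    using divides_trans[OF q(3) down q(1)] .
  ultimately have "q divides D"
    using irreducible_divides_mult[OF q(1,2) D(1), of "pow_\<sigma> (int n) b"] b(1) by simp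
  then obtain i where i: "i \<in> {1..n}" "q divides pow_\<sigma> (int i) a"
    using D_div q by blast
  \<comment> \<open>\<open>orbit\<close> is applied to \<open>q\<close> itself. Since \<sigma>^i(a)
    with \<open>i \<ge> 1\<close> is divisible by \<open>q\<close>, the exponent below is strictly
    negative even if \<open>l' = 0\<close>.\<close>
  obtain l' :: nat where "q \<sim> pow_\<sigma> (- int n * int l') a\<^sub>0"
    using orbit[OF q] by blast
  then have "pow_\<sigma> (- int n * int l') a\<^sub>0 divides q"
    by (simp add: associated_def)
  then have "pow_\<sigma> (- int n * int l') a\<^sub>0 divides pow_\<sigma> (int i) a"
    using divides_trans[OF _ i(2)] by simp
  then have "pow_\<sigma> (- int n * int l' - int i) a\<^sub>0 divides a"
    using pow_\<sigma>_divides_iff[OF a\<^sub>0_closed a_closed] by blast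
  moreover have "- int n * int l' - int i = - int (n * l' + i)"
    by simp
  moreover have "n * l' + i > 0"
    using i(1) by simp
  ultimately show False
    using a\<^sub>0_minimal by metis
qed

text \<open>A nonzero multiple of some \<open>e i\<close> wraps around to one of \<open>e 1\<close>,
  so the coefficient ideal is nonzero. Its generator is then a unit, \<open>N\<close> contains
  \<open>e 1\<close>, and repeated x yields the whole basis.\<close>

lemma N_eq_carrier:
  assumes "N \<noteq> {\<zero>\<^bsub>M\<^esub>}"
  shows "N = carrier M"
proof -
  interpret M: module R M by (rule module_std_module)
  obtain r i where r: "r \<in> carrier R" "r \<noteq> \<zero>" "i \<in> {1..n}" "r \<odot>\<^bsub>M\<^esub> e i \<in> N"
    using smult_e_mem[OF assms] by blast
  define s where "s = a\<^sub>0 \<otimes> pow_\<sigma> (int i - int n - 1) r"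
  have s: "s \<in> coeff_ideal" "s \<noteq> \<zero>"
    using wrap_around[OF r(1,4,3)] r a\<^sub>0_nonzero by (auto simp: s_def coeff_ideal_def integral_iff)
  obtain b where b: "b \<in> carrier R" "coeff_ideal = PIdl b"
    using exists_gen[OF ideal_coeff_ideal] by blast
  have "b \<noteq> \<zero>"
    using s b by (auto simp: cgenideal_def)
  then have "PIdl b = carrier R"
    using coeff_ideal_generator_unit b ideal_eq_carrier_iff by blast
  then have "\<one> \<in> coeff_ideal"
    using b by simp
  then have e1: "\<one> \<odot>\<^bsub>M\<^esub> e 1 \<in> N"
    by (simp add: coeff_ideal_def)
  have e: "e i \<in> N" if "i \<in> {1..n}" for i
    using shift_up[OF one_closed e1, of "i - 1"] that std_basis_closed[of n i] by simp
  have "v \<in> N" if v: "v \<in> carrier M" for v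
  proof -
    have "(\<Oplus>\<^bsub>M\<^esub>i\<in>F. v i \<odot>\<^bsub>M\<^esub> e i) \<in> N" if "F \<subseteq> {1..n}" for F
      using finite_subset[OF that finite_atLeastAtMost] that
    proof (induction F)
      case (insert i F)
      then have cl: "v j \<in> carrier R" "v j \<odot>\<^bsub>M\<^esub> e j \<in> N" if "j \<in> insert i F" for j
        using that std_module_coord[OF v] N_smult[OF _ e] by blast+
      then have "(\<lambda>i. v i \<odot>\<^bsub>M\<^esub> e i) \<in> F \<rightarrow> carrier M" "v i \<odot>\<^bsub>M\<^esub> e i \<in> carrier M"
        using N_subset by blast+
      then show ?case
        using insert cl N_add by simp
    qed (simp add: N_zero)
    from this[of "{1..n}"] show ?thesis
      using std_module_expand[OF v] by simp
  qed
  then show ?thesis using N_subset by blast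
qed

end

lemma (in simple_setting) simple_module_V_module:
  assumes act: "V_action R \<sigma> a a\<^sub>0 n act"
  shows "simple_module (gwa R \<sigma> a) (V_module R n act)"
  unfolding simple_module_def
proof (intro conjI allI impI)
  let ?c = "\<lambda>s. ring_cong (gwa_gens R) (gwa_rels R \<sigma> a) `` {s}"
  show "left_module (gwa R \<sigma> a) (V_module R n act)"
    using act by (simp add: V_action_iff)
  have "e 1 1 = \<one>" "\<zero>\<^bsub>M\<^esub> 1 = \<zero>"
    using n_pos by (simp_all add: std_basis_def std_module_simps(2))
  then have "e 1 \<noteq> \<zero>\<^bsub>M\<^esub>" by force
  then show "carrier (V_module R n act) \<noteq> {\<zero>\<^bsub>V_module R n act\<^esub>}"
    using std_basis_closed[of n 1] by auto
  fix N assume "submodule N (gwa R \<sigma> a) (V_module R n act)"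
  then interpret N: submodule N "gwa R \<sigma> a" "V_module R n act" .
  have gen: "gen_action g v \<in> N" if "g \<in> gwa_gens R" "v \<in> N" for g v
  proof -
    have "?c (Gen g) \<in> carrier (gwa R \<sigma> a)"
      using that(1) by (simp add: gwa_def presented_ring_closed)
    then have "act (?c (Gen g)) v \<in> N"
      using N.smult_closed that(2) by simp
    moreover have "v \<in> carrier M"
      using N.subset that(2) by auto
    ultimately show ?thesis
      using act that(1) by (simp add: V_action_iff)
  qed
  interpret simple_setting_submodule R \<sigma> a a\<^sub>0 n N
  proof
    \<comment> \<open>A submodule is in particular a subgroup of the additive monoid, so
      \<open>one_closed\<close> and \<open>m_closed\<close> speak of zero and of sums.\<close>
    show "N \<subseteq> carrier M" "\<zero>\<^bsub>M\<^esub> \<in> N"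
      using N.subset N.one_closed by simp_all
    show "u \<oplus>\<^bsub>M\<^esub> v \<in> N" if "u \<in> N" "v \<in> N" for u v
      using N.m_closed that by simp
    show "r \<odot>\<^bsub>M\<^esub> v \<in> N" if "r \<in> carrier R" "v \<in> N" for r v
      using gen[of "Coef r"] that by (simp add: gwa_gens_def)
    show "\<xi> v \<in> N" "\<eta> v \<in> N" if "v \<in> N" for v
      using gen[of GenX] gen[of GenY] that by (simp_all add: gwa_gens_def)
  qed
  show "N = {\<zero>\<^bsub>V_module R n act\<^esub>} \<or> N = carrier (V_module R n act)"
    using N_eq_carrier by auto
qed

text \<open>Defining an action by its values on multiples of the basis vectors asserts existence and
  uniqueness; hence \<open>\<exists>!act\<close> comes first and the properties of that action
  follow.\<close>

theorem theorem5p7: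
  fixes R :: "('a, 'b) ring_scheme" (structure)
    and \<sigma> :: "'a \<Rightarrow> 'a" and a a\<^sub>0 :: 'a and n :: nat
  assumes "principal_domain R"
    and "\<sigma> \<in> carrier (ring_AutoGroup R)"
    and "a \<in> carrier R" and "a \<noteq> \<zero>" and "a \<notin> Units R"
    and "\<forall>\<Omega> \<in> orbits (subgroup_generated (ring_AutoGroup R) {\<sigma>}) (Irr R) (class_action R).
          infinite \<Omega>"
    and "a\<^sub>0 \<in> carrier R" and "ring_irreducible a\<^sub>0" and "a\<^sub>0 divides a"
    and "\<And>k::nat. k > 0 \<Longrightarrow> \<not> (\<sigma> [^]\<^bsub>ring_AutoGroup R\<^esub> (- int k)) a\<^sub>0 divides a"
    and "n \<ge> 1"
  shows "(\<exists>!act. V_action R \<sigma> a a\<^sub>0 n act) \<and>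
    (\<forall>act. V_action R \<sigma> a a\<^sub>0 n act \<longrightarrow>
      simple_module (gwa R \<sigma> a) (V_module R n act) \<and>
      free_of_rank R (restrict_scalars (gwa_coef R \<sigma> a) (V_module R n act)) n)"
proof -
  interpret principal_domain R by fact
  interpret simple_setting R \<sigma> a a\<^sub>0 n
    \<comment> \<open>Irreducibility supplies \<open>a\<^sub>0 \<noteq> \<zero>\<close>, required by
      \<open>V_setting\<close>.\<close>
    using assms ring_irreducibleE(1)[OF assms(7,8)]
    by (intro simple_setting.intro V_setting.intro infinite_orbits.intro domain_automorphism.intro
        domain_automorphism_axioms.intro V_setting_axioms.intro infinite_orbits_axioms.intro
        simple_setting_axioms.intro) auto
  show ?thesis
    using V_action_exists V_action_unique simple_module_V_module free_of_rank_V_module by blast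
qed

end
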